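(* The set $R^+_{ure}$ of all $e$ such that $\mathrm{RTD}^+(\mathcal L_e)$ is finite and witnessed by a uniformly r.e. positive teaching sequence for $\mathcal L_e$ is $\Sigma^0_5$-complete.
   Context: $W_0,W_1,\ldots$ is an acceptable numbering of all r.e. subsets of $\mathbb N$; $L^e_j = \{x : \langle j,x\rangle \in W_e\}$ and $\mathcal L_e = \{L^e_j : j\in\mathbb N\}$. A positive teaching sequence for a family $\mathcal L$ is a sequence $((\mathcal F_0,d_0),(\mathcal F_1,d_1),\ldots)$ (indexed by an initial segment of $\mathbb N$) such that (i) the $\mathcal F_i$ are nonempty and form a partition of $\mathcal L$, and (ii) for every $i$ and every $L\in\mathcal F_i$ there is $S_L\subseteq L$ with $|S_L| = d_i<\infty$ such that for all $L'\in\bigcup_{j\geq i}\mathcal F_j$, $S_L\subseteq L'$ implies $L=L'$. Its order is $\sup_i d_i$, and $\mathrm{RTD}^+(\mathcal L)$ is the infimum of orders of positive teaching sequences for $\mathcal L$. The sequence is uniformly r.e. if there is an r.e. set $W$ with $\mathcal F_i = \{\{x : \langle i,j,x\rangle\in W\} : j\in\mathbb N\}$ for all $i$. "Finite and witnessed by" means there is such a uniformly r.e. positive teaching sequence of finite order. $\Sigma^0_5$-complete means definable by a $\Sigma^0_5$ formula and every $\Sigma^0_5$ set many-one reduces to it via a recursive function. *)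

theory Defs
  imports Main "HOL-Library.Nat_Bijection" "HOL-Library.Extended_Nat" "HOL-Library.Disjoint_Sets"
begin

section \<open>Recursive functions, r.e. sets and the arithmetical hierarchy\<close>

text \<open>
  \<open>recursive_fn k f\<close>: \<open>f\<close>, regarded as a function of \<open>k\<close> arguments, is (total) recursive.
  Arguments are passed as lists; by the rule \<open>recursive_fn.ext\<close> only the values on lists of length \<open>k\<close> matter.
  Minimization is restricted to regular functions, so partial functions never arise.
\<close>

inductive recursive_fn :: "nat \<Rightarrow> (nat list \<Rightarrow> nat) \<Rightarrow> bool" where
  zero: "recursive_fn k (\<lambda>xs. 0)"
| succ: "recursive_fn 1 (\<lambda>xs. Suc (xs ! 0))"
| proj: "i < k \<Longrightarrow> recursive_fn k (\<lambda>xs. xs ! i)"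
| comp: "recursive_fn (length hs) g \<Longrightarrow> (\<forall>h\<in>set hs. recursive_fn k h) \<Longrightarrow>
    recursive_fn k (\<lambda>xs. g (map (\<lambda>h. h xs) hs))"
| prec: "recursive_fn k g \<Longrightarrow> recursive_fn (Suc (Suc k)) h \<Longrightarrow>
    recursive_fn (Suc k) (\<lambda>xs. rec_nat (g (tl xs)) (\<lambda>n r. h (n # r # tl xs)) (hd xs))"
| mu: "recursive_fn (Suc k) f \<Longrightarrow> (\<forall>xs. length xs = k \<longrightarrow> (\<exists>y. f (y # xs) = 0)) \<Longrightarrow>
    recursive_fn k (\<lambda>xs. LEAST y. f (y # xs) = 0)"
| ext: "recursive_fn k f \<Longrightarrow> (\<forall>xs. length xs = k \<longrightarrow> g xs = f xs) \<Longrightarrow> recursive_fn k g"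

definition recursive :: "(nat \<Rightarrow> nat) \<Rightarrow> bool" where
  "recursive f \<longleftrightarrow> recursive_fn 1 (\<lambda>xs. f (xs ! 0))"

definition recursive_rel :: "nat \<Rightarrow> (nat list \<Rightarrow> bool) \<Rightarrow> bool" where
  "recursive_rel k P \<longleftrightarrow> recursive_fn k (\<lambda>xs. if P xs then 1 else 0)"

definition re :: "nat set \<Rightarrow> bool" where
  "re A \<longleftrightarrow> A = {} \<or> (\<exists>f. recursive f \<and> A = range f)"

text \<open>
  \<open>k\<close>-ary relations definable by a prefix of \<open>n\<close> alternating quantifiers (the outermost one
  existential for \<open>Sigma0_rel\<close> and universal for \<open>Pi0_rel\<close>) in front of a recursive relation.
\<close>

fun Sigma0_rel :: "nat \<Rightarrow> nat \<Rightarrow> (nat list \<Rightarrow> bool) \<Rightarrow> bool"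
  and Pi0_rel :: "nat \<Rightarrow> nat \<Rightarrow> (nat list \<Rightarrow> bool) \<Rightarrow> bool" where
  "Sigma0_rel 0 k P \<longleftrightarrow> recursive_rel k P"
| "Sigma0_rel (Suc n) k P \<longleftrightarrow>
    (\<exists>Q. Pi0_rel n (Suc k) Q \<and> (\<forall>xs. length xs = k \<longrightarrow> (P xs \<longleftrightarrow> (\<exists>y. Q (y # xs)))))"
| "Pi0_rel 0 k P \<longleftrightarrow> recursive_rel k P"
| "Pi0_rel (Suc n) k P \<longleftrightarrow>
    (\<exists>Q. Sigma0_rel n (Suc k) Q \<and> (\<forall>xs. length xs = k \<longrightarrow> (P xs \<longleftrightarrow> (\<forall>y. Q (y # xs)))))"

definition Sigma0 :: "nat \<Rightarrow> nat set \<Rightarrow> bool" where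
  "Sigma0 n A \<longleftrightarrow> Sigma0_rel n 1 (\<lambda>xs. xs ! 0 \<in> A)"

definition many_one_reducible :: "nat set \<Rightarrow> nat set \<Rightarrow> bool" where
  "many_one_reducible A B \<longleftrightarrow> (\<exists>f. recursive f \<and> (\<forall>x. x \<in> A \<longleftrightarrow> f x \<in> B))"

definition Sigma0_complete :: "nat \<Rightarrow> nat set \<Rightarrow> bool" where
  "Sigma0_complete n A \<longleftrightarrow> Sigma0 n A \<and> (\<forall>B. Sigma0 n B \<longrightarrow> many_one_reducible B A)"

text \<open>
  The pairing function is \<^const>\<open>prod_encode\<close>, and triples are \<open>\<langle>i, j, x\<rangle> = \<langle>i, \<langle>j, x\<rangle>\<rangle>\<close>.
  A numbering of the r.e. sets is acceptable if it is uniformly r.e. and every uniformly r.e.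
  numbering can be translated into it by a recursive function.
\<close>

definition acceptable_numbering :: "(nat \<Rightarrow> nat set) \<Rightarrow> bool" where
  "acceptable_numbering W \<longleftrightarrow>
     range W = {A. re A} \<and>
     re {prod_encode (e, x) | e x. x \<in> W e} \<and>
     (\<forall>V. re V \<longrightarrow> (\<exists>g. recursive g \<and> (\<forall>i. W (g i) = {x. prod_encode (i, x) \<in> V})))"

definition lang :: "(nat \<Rightarrow> nat set) \<Rightarrow> nat \<Rightarrow> nat \<Rightarrow> nat set" where
  "lang W e j = {x. prod_encode (j, x) \<in> W e}"

definition lang_family :: "(nat \<Rightarrow> nat set) \<Rightarrow> nat \<Rightarrow> nat set set" where
  "lang_family W e = range (lang W e)"


section \<open>Positive teaching sequences\<close>

text \<open>
  A sequence \<open>((F 0, d 0), (F 1, d 1), \<dots>)\<close> of length \<open>N \<le> \<infinity>\<close> is given by \<open>N\<close>, \<open>F\<close> and \<open>d\<close>;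
  values of \<open>F\<close> and \<open>d\<close> outside \<open>indices N\<close> are irrelevant.
\<close>

definition indices :: "enat \<Rightarrow> nat set" where
  "indices N = {i. enat i < N}"

definition positive_teaching_seq ::
    "nat set set \<Rightarrow> enat \<Rightarrow> (nat \<Rightarrow> nat set set) \<Rightarrow> (nat \<Rightarrow> nat) \<Rightarrow> bool" where
  "positive_teaching_seq \<L> N F d \<longleftrightarrow>
     (\<forall>i\<in>indices N. F i \<noteq> {}) \<and>
     disjoint_family_on F (indices N) \<and>
     (\<Union>i\<in>indices N. F i) = \<L> \<and>
     (\<forall>i\<in>indices N. \<forall>L\<in>F i. \<exists>S\<subseteq>L. finite S \<and> card S = d i \<and>
        (\<forall>L'\<in>(\<Union>j\<in>{j\<in>indices N. i \<le> j}. F j). S \<subseteq> L' \<longrightarrow> L = L'))"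

definition seq_order :: "enat \<Rightarrow> (nat \<Rightarrow> nat) \<Rightarrow> enat" where
  "seq_order N d = (SUP i\<in>indices N. enat (d i))"

definition RTD_plus :: "nat set set \<Rightarrow> enat" where
  "RTD_plus \<L> = Inf {seq_order N d | N F d. positive_teaching_seq \<L> N F d}"

definition uniformly_re_seq :: "enat \<Rightarrow> (nat \<Rightarrow> nat set set) \<Rightarrow> bool" where
  "uniformly_re_seq N F \<longleftrightarrow>
     (\<exists>V. re V \<and>
        (\<forall>i\<in>indices N. F i = range (\<lambda>j. {x. prod_encode (i, prod_encode (j, x)) \<in> V})))"

definition R_plus_ure :: "(nat \<Rightarrow> nat set) \<Rightarrow> nat set" where
  "R_plus_ure W =
     {e. RTD_plus (lang_family W e) < \<infinity> \<and>
         (\<exists>N F d. positive_teaching_seq (lang_family W e) N F d \<and>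
            uniformly_re_seq N F \<and> seq_order N d < \<infinity>)}"

end

theory Submission imports Defs begin

text \<open>
  A witness \<open>v\<close> for the uniformly r.e. set, the length \<open>N\<close> and the order bound is guessed by the leading
  existential quantifier; the remaining conditions are \<open>\<Pi>\<^sub>4\<close>, so the set is \<open>\<Sigma>\<^sub>5\<close>.

  For hardness, write \<open>x \<in> B\<close> as \<open>\<exists>a. Q a x\<close> with \<open>Q\<close> in \<open>\<Pi>\<^sub>4\<close>. Existential witnesses of \<open>\<not> Q\<close> can be
  made unique, which yields a \<open>\<Pi>\<^sub>3\<close> relation \<open>P\<close> on pairs \<open>g = \<langle>w, b\<rangle>\<close> such that \<open>P g\<close> holds for finitely many
  \<open>g\<close> if \<open>x \<in> B\<close>, and for some \<open>b\<close> for every \<open>w\<close> if \<open>x \<notin> B\<close>. Every \<open>g\<close> contributes a gadget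
  consisting of a set \<open>V\<close> and sets \<open>U\<^sub>c\<close> that exhaust \<open>V\<close>. If \<open>P g\<close> fails then almost all \<open>U\<^sub>c\<close> are equal
  to \<open>V\<close>, and every member of the gadget is identified by a single element. If \<open>P g\<close> holds then \<open>U\<^sub>c \<noteq> V\<close> for
  all \<open>c\<close>; now \<open>V\<close> has no finite teaching set and must be placed strictly after almost all \<open>U\<^sub>c\<close>.
  Finitely many such gadgets can be hard-wired into a uniformly r.e. sequence. On the other hand, if
  \<open>w\<close> codes a potential uniformly r.e. teaching sequence, then as soon as this sequence is seen to place
  members of the gadget \<open>\<langle>w, b\<rangle>\<close> in two different blocks, the gadget is collapsed to a single set,
  which contradicts the disjointness of the blocks; if it never does, \<open>V\<close> is not placed after any \<open>U\<^sub>c\<close>.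
  So the sequence fails on a gadget \<open>\<langle>w, b\<rangle>\<close> for which
  \<open>P\<close> holds.
\<close>

subsection \<open>Recursive functions\<close>

lemma rfn_const: "recursive_fn k (\<lambda>xs. c)"
proof (induction c)
  case 0
  show ?case by (rule recursive_fn.zero)
next
  case (Suc c)
  have "recursive_fn k (\<lambda>xs. (\<lambda>ys. Suc (ys ! 0)) (map (\<lambda>h. h xs) [\<lambda>xs. c]))"
    using Suc by (intro recursive_fn.comp) (auto intro: recursive_fn.succ[simplified])
  then show ?case by simp
qed

lemma rfn_app1:
  assumes "recursive_fn 1 (\<lambda>xs. g (xs ! 0))" "recursive_fn k f"
  shows "recursive_fn k (\<lambda>xs. g (f xs))"
  using recursive_fn.comp[of "[f]" "\<lambda>xs. g (xs ! 0)" k] assms by simp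

lemma rfn_app2:
  assumes "recursive_fn 2 (\<lambda>xs. g (xs ! 0) (xs ! 1))" "recursive_fn k f1" "recursive_fn k f2"
  shows "recursive_fn k (\<lambda>xs. g (f1 xs) (f2 xs))"
  using recursive_fn.comp[of "[f1, f2]" "\<lambda>xs. g (xs ! 0) (xs ! 1)" k] assms
  by (simp add: numeral_2_eq_2)

text \<open>Composition replaces the whole argument list, so projections are added to the inner
  functions to keep the old arguments available behind the computed ones. In particular a recursion
  can be run up to a computed bound, see \<open>rfn_rec\<close>.\<close>

lemma rfn_subst_vars:
  assumes f: "recursive_fn (length hs + k) f" and hs: "\<forall>h\<in>set hs. recursive_fn k h"
  shows "recursive_fn k (\<lambda>xs. f (map (\<lambda>h. h xs) hs @ xs))"
proof -
  let ?ps = "map (\<lambda>i xs. xs ! i) [0..<k] :: (nat list \<Rightarrow> nat) list"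
  have "recursive_fn k (\<lambda>xs. f (map (\<lambda>h. h xs) (hs @ ?ps)))"
    using f hs by (intro recursive_fn.comp) (auto intro: recursive_fn.proj)
  moreover have "map (\<lambda>h. h xs) ?ps = xs" if "length xs = k" for xs :: "nat list"
    using that map_nth[of xs] by (simp add: comp_def)
  ultimately show ?thesis by (elim recursive_fn.ext) (auto simp: comp_def)
qed

lemma rfn_tl:
  assumes "recursive_fn k f"
  shows "recursive_fn (Suc k) (\<lambda>xs. f (tl xs))"
proof -
  let ?ps = "map (\<lambda>i xs. xs ! Suc i) [0..<k] :: (nat list \<Rightarrow> nat) list"
  have "recursive_fn (Suc k) (\<lambda>xs. f (map (\<lambda>h. h xs) ?ps))"
    using assms by (intro recursive_fn.comp) (auto intro: recursive_fn.proj)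
  moreover have "map (\<lambda>h. h xs) ?ps = tl xs" if "length xs = Suc k" for xs :: "nat list"
    by (rule nth_equalityI) (use that in \<open>auto simp: nth_tl\<close>)
  ultimately show ?thesis by (elim recursive_fn.ext) auto
qed

lemma rfn_rec:
  assumes "recursive_fn k g" "recursive_fn (Suc (Suc k)) h" "recursive_fn k f"
  shows "recursive_fn k (\<lambda>xs. rec_nat (g xs) (\<lambda>n r. h (n # r # xs)) (f xs))"
  using rfn_subst_vars[of "[f]" k "\<lambda>xs. rec_nat (g (tl xs)) (\<lambda>n r. h (n # r # tl xs)) (hd xs)"]
    recursive_fn.prec[OF assms(1,2)] assms(3) by simp

lemma rfn_add: "recursive_fn 2 (\<lambda>xs. xs ! 0 + xs ! 1)"
proof -
  have "recursive_fn 2 (\<lambda>xs. rec_nat (xs ! 1) (\<lambda>n r. Suc ((n # r # xs) ! 1)) (xs ! 0))"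
    by (rule rfn_rec[where h = "\<lambda>ys. Suc (ys ! 1)"], rule recursive_fn.proj, simp,
        rule rfn_app1[OF recursive_fn.succ]) (simp_all add: recursive_fn.proj)
  moreover have "rec_nat a (\<lambda>n r. Suc ((n # r # xs) ! 1)) b = b + a" for a b and xs :: "nat list"
    by (induction b) auto
  ultimately show ?thesis by simp
qed

lemma rfn_pred: "recursive_fn 1 (\<lambda>xs. xs ! 0 - 1)"
proof -
  have "recursive_fn 1 (\<lambda>xs. rec_nat 0 (\<lambda>n r. (n # r # xs) ! 0) (xs ! 0))"
    by (rule rfn_rec[where h = "\<lambda>ys. ys ! 0"]) (simp_all add: recursive_fn.proj rfn_const)
  moreover have "rec_nat 0 (\<lambda>n r. (n # r # xs) ! 0) b = b - 1" for b and xs :: "nat list"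
    by (induction b) auto
  ultimately show ?thesis by simp
qed

lemma rfn_diff: "recursive_fn 2 (\<lambda>xs. xs ! 0 - xs ! 1)"
proof -
  have "recursive_fn 2 (\<lambda>xs. rec_nat (xs ! 0) (\<lambda>n r. (n # r # xs) ! 1 - 1) (xs ! 1))"
    by (rule rfn_rec[where h = "\<lambda>ys. ys ! 1 - 1"], rule recursive_fn.proj, simp,
        rule rfn_app1[OF rfn_pred]) (simp_all add: recursive_fn.proj)
  moreover have "rec_nat a (\<lambda>n r. (n # r # xs) ! 1 - 1) b = a - b" for a b and xs :: "nat list"
    by (induction b) auto
  ultimately show ?thesis by simp
qed

lemma rfn_triangle: "recursive_fn 1 (\<lambda>xs. triangle (xs ! 0))"
proof -
  have "recursive_fn 1 (\<lambda>xs. rec_nat 0 (\<lambda>n r. (n # r # xs) ! 1 + Suc ((n # r # xs) ! 0)) (xs ! 0))"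
    by (rule rfn_rec[where h = "\<lambda>ys. ys ! 1 + Suc (ys ! 0)"], rule rfn_const,
        rule rfn_app2[OF rfn_add], rule recursive_fn.proj, simp, rule rfn_app1[OF recursive_fn.succ])
      (simp_all add: recursive_fn.proj)
  moreover have "rec_nat 0 (\<lambda>n r. (n # r # xs) ! 1 + Suc ((n # r # xs) ! 0)) b = triangle b"
    for b and xs :: "nat list"
    by (induction b) auto
  ultimately show ?thesis by simp
qed

section \<open>Pairing, its inverses, and closure properties of unary recursive functions\<close>

abbreviation pr :: "nat \<Rightarrow> nat \<Rightarrow> nat" where "pr a b \<equiv> prod_encode (a, b)"
definition p1 :: "nat \<Rightarrow> nat" where "p1 z = fst (prod_decode z)"
definition p2 :: "nat \<Rightarrow> nat" where "p2 z = snd (prod_decode z)"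

lemma p1_pr [simp]: "p1 (pr a b) = a" and p2_pr [simp]: "p2 (pr a b) = b"
  by (simp_all add: p1_def p2_def)

lemma pr_p1_p2 [simp]: "pr (p1 z) (p2 z) = z"
  by (simp add: p1_def p2_def)

lemma recursive_compose:
  assumes "recursive f" "recursive g"
  shows "recursive (\<lambda>x. f (g x))"
  using rfn_app1[of f 1 "\<lambda>xs. g (xs ! 0)"] assms by (simp add: recursive_def)

lemma recursive_compose2:
  assumes "recursive_fn 2 (\<lambda>xs. f (xs ! 0) (xs ! 1))" "recursive g" "recursive h"
  shows "recursive (\<lambda>x. f (g x) (h x))"
  using rfn_app2[OF assms(1), of 1 "\<lambda>xs. g (xs ! 0)" "\<lambda>xs. h (xs ! 0)"] assms
  by (simp add: recursive_def)

named_theorems rec_intros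

lemma recursive_id [rec_intros]: "recursive (\<lambda>x. x)"
  by (simp add: recursive_def recursive_fn.proj)

lemma recursive_const [rec_intros]: "recursive (\<lambda>x. c)"
  by (simp add: recursive_def rfn_const)

lemma recursive_Suc [rec_intros]: "recursive f \<Longrightarrow> recursive (\<lambda>x. Suc (f x))"
  by (rule recursive_compose[of Suc]) (use recursive_fn.succ in \<open>simp_all add: recursive_def\<close>)

lemma recursive_add [rec_intros]: "recursive f \<Longrightarrow> recursive g \<Longrightarrow> recursive (\<lambda>x. f x + g x)"
  by (rule recursive_compose2[OF rfn_add])

lemma recursive_diff [rec_intros]: "recursive f \<Longrightarrow> recursive g \<Longrightarrow> recursive (\<lambda>x. f x - g x)"
  by (rule recursive_compose2[OF rfn_diff])

lemma rfn_prod_encode: "recursive_fn 2 (\<lambda>xs. pr (xs ! 0) (xs ! 1))"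
  unfolding prod_encode_def prod.case
  by (intro rfn_app2[OF rfn_add] rfn_app1[OF rfn_triangle] recursive_fn.proj) auto

lemma recursive_pr [rec_intros]: "recursive f \<Longrightarrow> recursive g \<Longrightarrow> recursive (\<lambda>x. pr (f x) (g x))"
  by (rule recursive_compose2[OF rfn_prod_encode])

lemma triangle_strict_mono: "m < n \<Longrightarrow> triangle m < triangle n"
  by (rule lift_Suc_mono_less[where f = triangle]) auto

text \<open>Since \<open>pr a b = triangle (a + b) + a\<close>, the search returns the diagonal
  \<open>a + b\<close>, the least \<open>y\<close> with \<open>z < triangle (Suc y)\<close>. The
  condition is written with truncated subtraction because \<open>recursive_fn.mu\<close> searches
  for a zero.\<close>

lemma prod_decode_search:
  defines "s \<equiv> \<lambda>z. LEAST y. Suc z - triangle (Suc y) = 0"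
  shows "p1 z = z - triangle (s z)" "p2 z = s z - p1 z"
proof -
  obtain a b where z: "z = pr a b" by (metis pr_p1_p2)
  have "s z = a + b"
    unfolding s_def
  proof (rule Least_equality)
    show "Suc z - triangle (Suc (a + b)) = 0" by (simp add: z prod_encode_def)
  next
    fix y assume y: "Suc z - triangle (Suc y) = 0"
    show "a + b \<le> y"
    proof (rule ccontr)
      assume "\<not> a + b \<le> y"
      then have "triangle (Suc y) \<le> triangle (a + b)"
        by (metis Suc_leI le_less linorder_not_le order_refl triangle_strict_mono)
      with y show False by (simp add: z prod_encode_def)
    qed
  qed
  then show "p1 z = z - triangle (s z)" "p2 z = s z - p1 z"
    by (simp_all add: z) (simp_all add: prod_encode_def)
qed

lemma recursive_prod_decode: "recursive p1" "recursive p2"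
proof -
  let ?s = "\<lambda>xs. LEAST y. Suc ((y # xs) ! 1) - triangle (Suc ((y # xs) ! 0)) = 0"
  have ex: "\<exists>y. Suc z - triangle (Suc y) = 0" for z
    by (intro exI[of _ z]) simp
  have s: "recursive_fn 1 ?s"
    by (intro recursive_fn.mu allI impI rfn_app2[OF rfn_diff] rfn_app1[OF rfn_triangle]
        rfn_app1[OF recursive_fn.succ] recursive_fn.proj) (use ex in auto)
  show 1: "recursive p1"
    unfolding recursive_def prod_decode_search(1)
    using rfn_app2[OF rfn_diff recursive_fn.proj rfn_app1[OF rfn_triangle s], of 0] by simp
  show "recursive p2"
    unfolding recursive_def prod_decode_search(2)
    using rfn_app2[OF rfn_diff s 1[unfolded recursive_def]] by simp
qed

lemma recursive_p1 [rec_intros]: "recursive f \<Longrightarrow> recursive (\<lambda>x. p1 (f x))"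
  and recursive_p2 [rec_intros]: "recursive f \<Longrightarrow> recursive (\<lambda>x. p2 (f x))"
  by (rule recursive_compose; simp add: recursive_prod_decode)+

text \<open>The step function is tested on codes of triples (counter, previous value, parameter), so
  that its recursiveness is again a unary goal to which \<open>rec_intros\<close> applies.\<close>

lemma recursive_rec_nat:
  assumes g: "recursive g"
    and h: "recursive (\<lambda>z. h (p1 z) (p1 (p2 z)) (p2 (p2 z)))"
    and f: "recursive f"
  shows "recursive (\<lambda>x. rec_nat (g x) (\<lambda>n r. h n r x) (f x))"
proof -
  let ?H = "\<lambda>z. h (p1 z) (p1 (p2 z)) (p2 (p2 z))"
  have "recursive_fn 1 (\<lambda>xs. rec_nat (g (xs ! 0))
      (\<lambda>n r. ?H (pr ((n # r # xs) ! 0) (pr ((n # r # xs) ! 1) ((n # r # xs) ! 2)))) (f (xs ! 0)))"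
  proof (rule rfn_rec[where h = "\<lambda>ys. ?H (pr (ys ! 0) (pr (ys ! 1) (ys ! 2)))"])
    show "recursive_fn (Suc (Suc 1)) (\<lambda>ys. ?H (pr (ys ! 0) (pr (ys ! 1) (ys ! 2))))"
      by (rule rfn_app1[OF h[unfolded recursive_def]])
        (intro rfn_app2[OF rfn_prod_encode] recursive_fn.proj; simp)
  qed (use f g in \<open>simp_all add: recursive_def\<close>)
  then show ?thesis by (simp add: recursive_def)
qed

lemma recursive_if_zero:
  assumes "recursive c" "recursive f" "recursive g"
  shows "recursive (\<lambda>x. if c x = 0 then f x else g x)"
proof -
  have "recursive (\<lambda>x. rec_nat (f x) (\<lambda>n r. g x) (c x))"
    by (rule recursive_rec_nat[where h = "\<lambda>n r x. g x"])
      (intro assms rec_intros recursive_compose[OF assms(3), of "\<lambda>z. p2 (p2 z)"])+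
  moreover have "rec_nat a (\<lambda>n r. b) m = (if m = 0 then a else b)" for a b m :: nat
    by (cases m) auto
  ultimately show ?thesis by simp
qed

section \<open>Decidable predicates\<close>

definition dec :: "(nat \<Rightarrow> bool) \<Rightarrow> bool" where
  "dec P \<longleftrightarrow> recursive (\<lambda>x. if P x then 1 else 0)"

lemma dec_compose: "dec P \<Longrightarrow> recursive f \<Longrightarrow> dec (\<lambda>x. P (f x))"
  unfolding dec_def by (rule recursive_compose[of "\<lambda>x. if P x then 1 else 0"])

lemma recursive_if [rec_intros]:
  assumes "dec P" "recursive f" "recursive g"
  shows "recursive (\<lambda>x. if P x then f x else g x)"
proof -
  have "(if (if p then 1 else 0 :: nat) = 0 then a else b) = (if p then b else a)" for p and a b :: nat
    by simp
  then show ?thesis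
    using recursive_if_zero[OF assms(1)[unfolded dec_def] assms(3,2)] by (simp only:)
qed

lemma dec_const [rec_intros]: "dec (\<lambda>x. b)"
  by (simp add: dec_def recursive_const)

lemma dec_not [rec_intros]: "dec P \<Longrightarrow> dec (\<lambda>x. \<not> P x)"
proof -
  assume "dec P"
  then have "recursive (\<lambda>x. if P x then 0 else 1)"
    by (intro rec_intros)
  moreover have "(if p then 0 else 1) = (if \<not> p then 1 else 0 :: nat)" for p
    by simp
  ultimately show ?thesis by (simp only: dec_def)
qed

lemma dec_conj [rec_intros]: "dec P \<Longrightarrow> dec Q \<Longrightarrow> dec (\<lambda>x. P x \<and> Q x)"
proof -
  assume "dec P" "dec Q"
  then have "recursive (\<lambda>x. if P x then if Q x then 1 else 0 else 0)"
    by (intro rec_intros)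
  moreover have "(if p then if q then 1 else 0 else 0) = (if p \<and> q then 1 else 0 :: nat)" for p q
    by simp
  ultimately show ?thesis by (simp only: dec_def)
qed

lemma dec_disj [rec_intros]: "dec P \<Longrightarrow> dec Q \<Longrightarrow> dec (\<lambda>x. P x \<or> Q x)"
  using dec_not[OF dec_conj[OF dec_not dec_not], of P Q] by simp

lemma dec_imp [rec_intros]: "dec P \<Longrightarrow> dec Q \<Longrightarrow> dec (\<lambda>x. P x \<longrightarrow> Q x)"
  using dec_disj[OF dec_not, of P Q] by (simp only: imp_conv_disj)

lemma dec_le [rec_intros]:
  assumes "recursive f" "recursive g"
  shows "dec (\<lambda>x. f x \<le> g x)"
  using recursive_if_zero[OF recursive_diff[OF assms] recursive_const[of 1] recursive_const[of 0]]
  by (simp add: dec_def)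

lemma dec_less [rec_intros]: "recursive f \<Longrightarrow> recursive g \<Longrightarrow> dec (\<lambda>x. f x < g x)"
  using dec_le[OF recursive_Suc] by (simp add: Suc_le_eq)

lemma dec_eq [rec_intros]: "recursive f \<Longrightarrow> recursive g \<Longrightarrow> dec (\<lambda>x. f x = g x)"
  unfolding eq_iff by (intro rec_intros)

lemma dec_finite: "finite A \<Longrightarrow> dec (\<lambda>x. x \<in> A)"
proof (induction rule: finite_induct)
  case (insert a A)
  then show ?case by (simp only: insert_iff) (intro rec_intros)
qed (simp add: dec_const)

lemma dec_ball_less [rec_intros]:
  assumes f: "recursive f" and P: "dec (\<lambda>z. P (p1 z) (p2 z))"
  shows "dec (\<lambda>x. \<forall>i<f x. P i x)"
proof -
  \<comment> \<open>The recursion below runs on triples whose middle entry is the accumulator, which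
    \<open>P\<close> has to skip.\<close>
  have "recursive (\<lambda>z. pr (p1 z) (p2 (p2 z)))"
    by (intro rec_intros)
  from dec_compose[OF P this] have P': "dec (\<lambda>z. P (p1 z) (p2 (p2 z)))"
    by simp
  have "recursive (\<lambda>x. rec_nat 1 (\<lambda>i r. if P i x then r else 0) (f x))"
    by (rule recursive_rec_nat[where h = "\<lambda>i r x. if P i x then r else 0"])
      (intro rec_intros f P')+
  moreover have "rec_nat 1 (\<lambda>i r. if P i x then r else 0) n = (if \<forall>i<n. P i x then 1 else 0 :: nat)" for n x
    by (induction n) (auto simp: less_Suc_eq)
  ultimately show ?thesis by (simp only: dec_def)
qed

lemma dec_bex_less [rec_intros]:
  assumes "recursive f" "dec (\<lambda>z. P (p1 z) (p2 z))"
  shows "dec (\<lambda>x. \<exists>i<f x. P i x)"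
  using dec_not[OF dec_ball_less[of f "\<lambda>i x. \<not> P i x"]] assms by (simp add: dec_not)

lemma recursive_Least:
  assumes P: "dec (\<lambda>z. P (p1 z) (p2 z))" and ex: "\<And>x. \<exists>y. P y x"
  shows "recursive (\<lambda>x. LEAST y. P y x)"
proof -
  let ?f = "\<lambda>z. if P (p1 z) (p2 z) then 0 else 1 :: nat"
  have "recursive ?f" by (intro rec_intros P)
  then have "recursive_fn 2 (\<lambda>xs. ?f (pr (xs ! 0) (xs ! 1)))"
    unfolding recursive_def
    by (rule rfn_app1) (intro rfn_app2[OF rfn_prod_encode] recursive_fn.proj; simp)
  then have "recursive_fn 1 (\<lambda>xs. LEAST y. ?f (pr ((y # xs) ! 0) ((y # xs) ! 1)) = 0)"
    by (intro recursive_fn.mu) (use ex in \<open>auto simp: numeral_2_eq_2 split: if_splits\<close>)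
  moreover have "(LEAST y. (if P y x then 0 else 1 :: nat) = 0) = (LEAST y. P y x)" for x
    by (rule arg_cong[where f = Least]) auto
  ultimately show ?thesis by (simp add: recursive_def)
qed

section \<open>Lists coded by numbers\<close>

fun drop_code :: "nat \<Rightarrow> nat \<Rightarrow> nat" where
  "drop_code 0 z = z"
| "drop_code (Suc i) z = p2 (drop_code i z - 1)"

definition nth_code :: "nat \<Rightarrow> nat \<Rightarrow> nat" where
  "nth_code z i = p1 (drop_code i z - 1)"

definition length_code :: "nat \<Rightarrow> nat" where
  "length_code z = length (list_decode z)"

lemma list_encode_eq_0_iff [simp]: "list_encode xs = 0 \<longleftrightarrow> xs = []"
  by (cases xs) auto

lemma p2_0 [simp]: "p2 0 = 0"
  using p2_pr[of 0 0] by (simp add: prod_encode_def)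

text \<open>\<open>list_encode (x # xs)\<close> is \<open>Suc (pr x (list_encode xs))\<close>, so
  subtracting 1 and applying \<open>p2\<close> passes to the code of the tail. The empty list is a
  fixed point because \<open>p2 0 = 0\<close>.\<close>

lemma drop_code_list_encode: "drop_code i (list_encode xs) = list_encode (drop i xs)"
proof (induction i)
  case (Suc i)
  then show ?case
    by (cases "drop i xs") (auto simp: drop_Suc tl_drop[symmetric])
qed simp

lemma nth_code_list_encode: "i < length xs \<Longrightarrow> nth_code (list_encode xs) i = xs ! i"
  by (simp add: nth_code_def drop_code_list_encode Cons_nth_drop_Suc[symmetric])

lemma length_code_list_encode [simp]: "length_code (list_encode xs) = length xs"
  by (simp add: length_code_def)

text \<open>Only the empty list has code 0. This form is a minimization, from which recursiveness of
  the length follows.\<close>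

lemma length_code_eq: "length_code z = (LEAST n. drop_code n z = 0)"
proof -
  obtain xs where z: "z = list_encode xs" by (metis list_decode_inverse)
  show ?thesis
    by (rule sym, rule Least_equality) (auto simp: z drop_code_list_encode)
qed

lemma ex_list_code: "\<exists>z. length_code z = n \<and> (\<forall>i<n. nth_code z i = f i)"
  by (rule exI[of _ "list_encode (map f [0..<n])"]) (simp add: nth_code_list_encode)

lemma list_code_eqI:
  assumes "length_code z = length_code z'"
    and "\<And>i. i < length_code z \<Longrightarrow> nth_code z i = nth_code z' i"
  shows "z = z'"
proof -
  obtain xs ys where "z = list_encode xs" "z' = list_encode ys" by (metis list_decode_inverse)
  with assms show ?thesis
    by (auto simp: nth_code_list_encode intro!: arg_cong[of _ _ list_encode] nth_equalityI)
qed

lemma recursive_drop_code [rec_intros]: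
  assumes "recursive f" "recursive g"
  shows "recursive (\<lambda>x. drop_code (f x) (g x))"
proof -
  have "drop_code i z = rec_nat z (\<lambda>n r. p2 (r - 1)) i" for i z
    by (induction i) auto
  moreover have "recursive (\<lambda>x. rec_nat (g x) (\<lambda>n r. p2 (r - 1)) (f x))"
    by (rule recursive_rec_nat[where h = "\<lambda>n r x. p2 (r - 1)"]) (intro rec_intros assms)+
  ultimately show ?thesis by simp
qed

lemma recursive_nth_code [rec_intros]:
  "recursive f \<Longrightarrow> recursive g \<Longrightarrow> recursive (\<lambda>x. nth_code (f x) (g x))"
  unfolding nth_code_def by (intro rec_intros)

lemma recursive_length_code [rec_intros]:
  assumes "recursive f"
  shows "recursive (\<lambda>x. length_code (f x))"
proof -
  have "\<exists>n. drop_code n (f x) = 0" for x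
  proof -
    obtain xs where "f x = list_encode xs" by (metis list_decode_inverse)
    then show ?thesis by (auto simp: drop_code_list_encode intro: exI[of _ "length xs"])
  qed
  then show ?thesis
    unfolding length_code_eq by (intro recursive_Least rec_intros recursive_compose[OF assms])
qed

subsection \<open>The arithmetical hierarchy\<close>

text \<open>
  Unary versions of the classes \<open>\<Sigma>\<^sub>n\<close> and \<open>\<Pi>\<^sub>n\<close>: a quantified variable is paired to the left of the
  remaining arguments.
\<close>

fun sg :: "nat \<Rightarrow> (nat \<Rightarrow> bool) \<Rightarrow> bool" where
  "sg 0 P \<longleftrightarrow> dec P"
| "sg (Suc n) P \<longleftrightarrow> (\<exists>Q. sg n (\<lambda>z. \<not> Q z) \<and> (\<forall>x. P x \<longleftrightarrow> (\<exists>y. Q (pr y x))))"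

definition pg :: "nat \<Rightarrow> (nat \<Rightarrow> bool) \<Rightarrow> bool" where
  "pg n P \<longleftrightarrow> sg n (\<lambda>x. \<not> P x)"

lemma sg_not: "pg n P \<Longrightarrow> sg n (\<lambda>x. \<not> P x)"
  and pg_not: "sg n P \<Longrightarrow> pg n (\<lambda>x. \<not> P x)"
  by (simp_all add: pg_def)

lemma pg_0 [simp]: "pg 0 P \<longleftrightarrow> dec P"
  using dec_not[of P] dec_not[of "\<lambda>x. \<not> P x"] by (auto simp: pg_def)

lemma sg_Suc: "sg (Suc n) P \<longleftrightarrow> (\<exists>Q. pg n Q \<and> (\<forall>x. P x \<longleftrightarrow> (\<exists>y. Q (pr y x))))"
  by (simp add: pg_def)

lemma pg_Suc: "pg (Suc n) P \<longleftrightarrow> (\<exists>Q. sg n Q \<and> (\<forall>x. P x \<longleftrightarrow> (\<forall>y. Q (pr y x))))"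
proof
  assume "pg (Suc n) P"
  then obtain Q where "sg n (\<lambda>z. \<not> Q z)" "\<forall>x. \<not> P x \<longleftrightarrow> (\<exists>y. Q (pr y x))"
    by (auto simp: pg_def)
  then show "\<exists>Q. sg n Q \<and> (\<forall>x. P x \<longleftrightarrow> (\<forall>y. Q (pr y x)))" by blast
next
  assume "\<exists>Q. sg n Q \<and> (\<forall>x. P x \<longleftrightarrow> (\<forall>y. Q (pr y x)))"
  then obtain Q where "sg n Q" "\<forall>x. P x \<longleftrightarrow> (\<forall>y. Q (pr y x))" by blast
  then show "pg (Suc n) P"
    by (auto simp: pg_def intro!: exI[of _ "\<lambda>z. \<not> Q z"])
qed

declare sg.simps(2) [simp del]

lemma sg_compose: "sg n P \<Longrightarrow> recursive f \<Longrightarrow> sg n (\<lambda>x. P (f x))"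
proof (induction n arbitrary: P f)
  case 0
  then show ?case by (simp add: dec_compose)
next
  case (Suc n)
  then obtain Q where Q: "pg n Q" "\<And>x. P x \<longleftrightarrow> (\<exists>y. Q (pr y x))" by (auto simp: sg_Suc)
  have "recursive (\<lambda>z. pr (p1 z) (f (p2 z)))"
    by (intro rec_intros recursive_compose[OF Suc.prems(2)])
  with Q(1) have "pg n (\<lambda>z. Q (pr (p1 z) (f (p2 z))))" unfolding pg_def by (rule Suc.IH)
  then show ?case by (auto simp: sg_Suc Q(2) intro!: exI[of _ "\<lambda>z. Q (pr (p1 z) (f (p2 z)))"])
qed

lemma pg_compose: "pg n P \<Longrightarrow> recursive f \<Longrightarrow> pg n (\<lambda>x. P (f x))"
  unfolding pg_def by (rule sg_compose)

lemma pg_imp_sg_Suc: "pg n P \<Longrightarrow> sg (Suc n) P"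
  using pg_compose[of n P p2] recursive_p2[OF recursive_id]
  by (auto simp: sg_Suc intro!: exI[of _ "\<lambda>z. P (p2 z)"])

lemma sg_Suc_mono: "sg n P \<Longrightarrow> sg (Suc n) P"
proof (induction n arbitrary: P)
  case 0
  then show ?case by (intro pg_imp_sg_Suc) simp
next
  case (Suc n)
  then obtain Q where Q: "pg n Q" "\<forall>x. P x \<longleftrightarrow> (\<exists>y. Q (pr y x))" by (auto simp: sg_Suc)
  from Suc.IH[OF Q(1)[unfolded pg_def]] have "pg (Suc n) Q" by (simp only: pg_def)
  with Q(2) show ?case unfolding sg_Suc[of "Suc n"] by blast
qed

lemma sg_mono: "sg m P \<Longrightarrow> m \<le> n \<Longrightarrow> sg n P"
  by (induction n) (auto simp: le_Suc_eq intro: sg_Suc_mono)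

lemma pg_mono: "pg m P \<Longrightarrow> m \<le> n \<Longrightarrow> pg n P"
  unfolding pg_def by (rule sg_mono)

lemma pg_imp_sg: "pg m P \<Longrightarrow> m < n \<Longrightarrow> sg n P"
  using pg_imp_sg_Suc sg_mono by (metis Suc_leI)

lemma sg_imp_pg: "sg m P \<Longrightarrow> m < n \<Longrightarrow> pg n P"
  unfolding pg_def by (rule pg_imp_sg[OF pg_not])

text \<open>One induction proves both closures, since the matrices are complements of
  \<open>sg n\<close> relations: a conjunction of matrices needs the disjunction at level
  \<open>n\<close>, and conversely. For the conjunction the two witnesses are paired; for the
  disjunction one witness serves either side.\<close>

lemma sg_conj_disj:
  "sg n P \<Longrightarrow> sg n Q \<Longrightarrow> sg n (\<lambda>x. P x \<and> Q x) \<and> sg n (\<lambda>x. P x \<or> Q x)"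
proof (induction n arbitrary: P Q)
  case 0
  then show ?case by (auto intro: rec_intros)
next
  case (Suc n)
  obtain A where A: "pg n A" "\<And>x. P x \<longleftrightarrow> (\<exists>y. A (pr y x))"
    using Suc.prems(1) by (auto simp: sg_Suc)
  obtain B where B: "pg n B" "\<And>x. Q x \<longleftrightarrow> (\<exists>y. B (pr y x))"
    using Suc.prems(2) by (auto simp: sg_Suc)
  have rec: "recursive (\<lambda>z. pr (p1 (p1 z)) (p2 z))" "recursive (\<lambda>z. pr (p2 (p1 z)) (p2 z))"
    by (intro rec_intros)+
  let ?C = "\<lambda>z. A (pr (p1 (p1 z)) (p2 z)) \<and> B (pr (p2 (p1 z)) (p2 z))"
  have "pg n ?C"
    using Suc.IH[OF pg_compose[OF A(1) rec(1), unfolded pg_def] pg_compose[OF B(1) rec(2), unfolded pg_def]]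
    by (simp add: pg_def)
  moreover have "(\<exists>y. ?C (pr y x)) \<longleftrightarrow> P x \<and> Q x" for x
    by (auto simp: A(2) B(2)) (metis p1_pr p2_pr)
  ultimately have "sg (Suc n) (\<lambda>x. P x \<and> Q x)"
    unfolding sg_Suc by (intro exI[of _ ?C]) blast
  moreover have "pg n (\<lambda>z. A z \<or> B z)"
    using Suc.IH[OF A(1)[unfolded pg_def] B(1)[unfolded pg_def]] by (simp add: pg_def)
  then have "sg (Suc n) (\<lambda>x. P x \<or> Q x)"
    unfolding sg_Suc by (intro exI[of _ "\<lambda>z. A z \<or> B z"]) (auto simp: A(2) B(2))
  ultimately show ?case ..
qed

named_theorems hier_intros

lemma sg_conj [hier_intros]: "sg n P \<Longrightarrow> sg n Q \<Longrightarrow> sg n (\<lambda>x. P x \<and> Q x)"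
  and sg_disj [hier_intros]: "sg n P \<Longrightarrow> sg n Q \<Longrightarrow> sg n (\<lambda>x. P x \<or> Q x)"
  using sg_conj_disj by auto

lemma pg_conj [hier_intros]: "pg n P \<Longrightarrow> pg n Q \<Longrightarrow> pg n (\<lambda>x. P x \<and> Q x)"
  and pg_disj [hier_intros]: "pg n P \<Longrightarrow> pg n Q \<Longrightarrow> pg n (\<lambda>x. P x \<or> Q x)"
  using sg_conj_disj[of n "\<lambda>x. \<not> P x" "\<lambda>x. \<not> Q x"] by (auto simp: pg_def)

declare sg_not [hier_intros] pg_not [hier_intros]

lemma pg_imp [hier_intros]: "sg n P \<Longrightarrow> pg n Q \<Longrightarrow> pg n (\<lambda>x. P x \<longrightarrow> Q x)"
  unfolding imp_conv_disj by (intro hier_intros)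

lemma sg_dec: "dec P \<Longrightarrow> sg n P"
  by (rule sg_mono[of 0]) simp_all

lemma pg_dec: "dec P \<Longrightarrow> pg n P"
  by (rule pg_mono[of 0]) simp_all

text \<open>The new variable and the witness inside \<open>P\<close> are packed into one number,
  which contracts two existential quantifiers.\<close>

lemma sg_ex:
  assumes "sg (Suc n) (\<lambda>z. P (p1 z) (p2 z))"
  shows "sg (Suc n) (\<lambda>x. \<exists>y. P y x)"
proof -
  obtain Q where Q: "pg n Q" "\<And>x. P (p1 x) (p2 x) \<longleftrightarrow> (\<exists>y. Q (pr y x))"
    using assms by (auto simp: sg_Suc)
  let ?Q = "\<lambda>z. Q (pr (p1 (p1 z)) (pr (p2 (p1 z)) (p2 z)))"
  have "recursive (\<lambda>z. pr (p1 (p1 z)) (pr (p2 (p1 z)) (p2 z)))" by (intro rec_intros)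
  with Q(1) have "pg n ?Q" by (rule pg_compose)
  moreover have "(\<exists>y. P y x) \<longleftrightarrow> (\<exists>y. ?Q (pr y x))" for x
    using Q(2)[of "pr _ x"] by (simp, metis p1_pr p2_pr)
  ultimately show ?thesis unfolding sg_Suc by blast
qed

lemma pg_all:
  assumes "pg (Suc n) (\<lambda>z. P (p1 z) (p2 z))"
  shows "pg (Suc n) (\<lambda>x. \<forall>y. P y x)"
  using sg_ex[of n "\<lambda>y x. \<not> P y x"] assms by (simp add: pg_def)

lemma sg_bex_less:
  assumes "recursive f" "sg (Suc n) (\<lambda>z. P (p1 z) (p2 z))"
  shows "sg (Suc n) (\<lambda>x. \<exists>i<f x. P i x)"
  by (intro sg_ex hier_intros sg_dec rec_intros recursive_compose[OF assms(1)] assms(2))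

lemma pg_ball_less:
  assumes "recursive f" "pg (Suc n) (\<lambda>z. P (p1 z) (p2 z))"
  shows "pg (Suc n) (\<lambda>x. \<forall>i<f x. P i x)"
  using sg_bex_less[of f n "\<lambda>i x. \<not> P i x"] assms by (simp add: pg_def)

text \<open>Finitely many witnesses have a common bound \<open>b\<close>. With \<open>b\<close>
  guessed first, what remains has only bounded quantifiers and is decidable.\<close>

lemma sg1_ball_less:
  assumes f: "recursive f" and P: "sg 1 (\<lambda>z. P (p1 z) (p2 z))"
  shows "sg 1 (\<lambda>x. \<forall>i<f x. P i x)"
proof -
  obtain Q where Q: "dec Q" "\<And>x. P (p1 x) (p2 x) \<longleftrightarrow> (\<exists>y. Q (pr y x))"
    using P by (auto simp: sg_Suc)
  have P_iff: "P i x \<longleftrightarrow> (\<exists>y. Q (pr y (pr i x)))" for i x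
    using Q(2)[of "pr i x"] by simp
  have "(\<forall>i<n. P i x) \<longleftrightarrow> (\<exists>b. \<forall>i<n. \<exists>y<b. Q (pr y (pr i x)))" for n x
  proof
    assume "\<forall>i<n. P i x"
    then have "\<forall>i. \<exists>y. i < n \<longrightarrow> Q (pr y (pr i x))" by (simp add: P_iff)
    then obtain w where w: "\<And>i. i < n \<Longrightarrow> Q (pr (w i) (pr i x))" by metis
    have "\<forall>i<n. \<exists>y<Suc (Max (w ` {..<n})). Q (pr y (pr i x))"
      using w by (auto intro!: exI[of _ "w _"] simp: less_Suc_eq_le)
    then show "\<exists>b. \<forall>i<n. \<exists>y<b. Q (pr y (pr i x))" by blast
  qed (auto simp: P_iff)
  moreover have "dec (\<lambda>z. \<forall>i<f (p2 z). \<exists>y<p1 z. Q (pr y (pr i (p2 z))))"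
    by (intro rec_intros recursive_compose[OF f] dec_compose[OF Q(1)])
  then have "sg 1 (\<lambda>x. \<exists>b. \<forall>i<f x. \<exists>y<b. Q (pr y (pr i x)))"
    unfolding One_nat_def by (intro sg_ex sg_dec)
  ultimately show ?thesis by simp
qed

lemma re_iff_sg: "re A \<longleftrightarrow> sg 1 (\<lambda>x. x \<in> A)"
proof
  assume "re A"
  then consider "A = {}" | f where "recursive f" "A = range f" by (auto simp: re_def)
  then show "sg 1 (\<lambda>x. x \<in> A)"
  proof cases
    case 1
    then show ?thesis by (simp add: sg_dec dec_const)
  next
    case 2
    from 2 have "sg 1 (\<lambda>x. \<exists>y. x = f y)"
      unfolding One_nat_def by (intro sg_ex sg_dec rec_intros recursive_compose[OF 2(1)])
    with 2 show ?thesis by (simp add: image_iff)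
  qed
next
  assume "sg 1 (\<lambda>x. x \<in> A)"
  then obtain Q where Q: "dec Q" "\<And>x. x \<in> A \<longleftrightarrow> (\<exists>y. Q (pr y x))"
    by (auto simp: sg_Suc)
  show "re A"
  proof (cases "A = {}")
    case False
    then obtain a where a: "a \<in> A" by auto
    \<comment> \<open>\<open>z\<close> is read as a witness paired with an element; \<open>a\<close>
      is the default output when the test \<open>Q z\<close> fails.\<close>
    have "recursive (\<lambda>z. if Q z then p2 z else a)" by (intro rec_intros Q(1))
    moreover have "A = range (\<lambda>z. if Q z then p2 z else a)"
    proof
      show "A \<subseteq> range (\<lambda>z. if Q z then p2 z else a)"
      proof
        fix x assume "x \<in> A"
        then obtain y where "Q (pr y x)" by (auto simp: Q(2))
        then show "x \<in> range (\<lambda>z. if Q z then p2 z else a)"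
          by (intro image_eqI[of _ _ "pr y x"]) auto
      qed
    next
      show "range (\<lambda>z. if Q z then p2 z else a) \<subseteq> A"
        using a by auto (metis Q(2) pr_p1_p2)
    qed
    ultimately show ?thesis unfolding re_def by blast
  qed (simp add: re_def)
qed

lemma sg_mem: "re A \<Longrightarrow> recursive f \<Longrightarrow> sg (Suc n) (\<lambda>x. f x \<in> A)"
  by (rule sg_mono[of 1], rule sg_compose[of 1 "\<lambda>x. x \<in> A"]) (simp_all add: re_iff_sg)

section \<open>Relations on argument lists versus predicates on codes\<close>

fun dec_list :: "nat \<Rightarrow> nat \<Rightarrow> nat list" where
  "dec_list 0 x = [x]"
| "dec_list (Suc k) x = p1 x # dec_list k (p2 x)"

fun enc_list :: "nat \<Rightarrow> nat list \<Rightarrow> nat" where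
  "enc_list 0 xs = hd xs"
| "enc_list (Suc k) xs = pr (hd xs) (enc_list k (tl xs))"

lemma length_dec_list [simp]: "length (dec_list k x) = Suc k"
  by (induction k arbitrary: x) auto

lemma enc_dec_list [simp]: "enc_list k (dec_list k x) = x"
  by (induction k arbitrary: x) auto

lemma dec_enc_list [simp]: "length xs = Suc k \<Longrightarrow> dec_list k (enc_list k xs) = xs"
  by (induction k arbitrary: xs) (auto simp: length_Suc_conv)

lemma rfn_enc_list: "recursive_fn (Suc k) (enc_list k)"
proof (induction k)
  case 0
  show ?case
    by (rule recursive_fn.ext[OF recursive_fn.proj[of 0]]) (auto simp: length_Suc_conv)
next
  case (Suc k)
  have "recursive_fn (Suc (Suc k)) (\<lambda>xs. pr (xs ! 0) (enc_list k (tl xs)))"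
    by (intro rfn_app2[OF rfn_prod_encode] recursive_fn.proj rfn_tl[OF Suc]) simp
  then show ?case
    by (rule recursive_fn.ext) (auto simp: length_Suc_conv)
qed

text \<open>\<open>recursive_fn.comp\<close> asks for the decoded components as an explicit list of
  functions.\<close>

lemma dec_list_components:
  "\<exists>hs. length hs = Suc k \<and> (\<forall>h\<in>set hs. recursive h) \<and> (\<forall>x. dec_list k x = map (\<lambda>h. h x) hs)"
proof (induction k)
  case 0
  show ?case by (rule exI[of _ "[\<lambda>x. x]"]) (simp add: recursive_id)
next
  case (Suc k)
  then obtain hs where hs: "length hs = Suc k" "\<forall>h\<in>set hs. recursive h"
    "\<forall>x. dec_list k x = map (\<lambda>h. h x) hs"
    by blast
  show ?case
    by (rule exI[of _ "p1 # map (\<lambda>h x. h (p2 x)) hs"])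
      (use hs in \<open>auto simp: recursive_prod_decode intro: recursive_compose\<close>)
qed

lemma recursive_fn_iff_recursive:
  "recursive_fn (Suc k) f \<longleftrightarrow> recursive (\<lambda>x. f (dec_list k x))"
proof
  assume f: "recursive_fn (Suc k) f"
  obtain hs where hs: "length hs = Suc k" "\<forall>h\<in>set hs. recursive h"
    "\<forall>x. dec_list k x = map (\<lambda>h. h x) hs"
    using dec_list_components by blast
  have "recursive_fn 1 (\<lambda>xs. f (map (\<lambda>h. h xs) (map (\<lambda>h xs. h (xs ! 0)) hs)))"
    using f hs(1,2) by (intro recursive_fn.comp) (auto simp: recursive_def)
  then show "recursive (\<lambda>x. f (dec_list k x))"
    by (simp add: recursive_def hs(3) comp_def)
next
  assume "recursive (\<lambda>x. f (dec_list k x))"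
  from rfn_app1[OF this[unfolded recursive_def] rfn_enc_list[of k]]
  show "recursive_fn (Suc k) f" by (rule recursive_fn.ext) simp
qed

lemma Sigma0_rel_Pi0_rel_iff:
  "(Sigma0_rel n (Suc k) P \<longleftrightarrow> sg n (\<lambda>x. P (dec_list k x))) \<and>
   (Pi0_rel n (Suc k) P \<longleftrightarrow> pg n (\<lambda>x. P (dec_list k x)))"
proof (induction n arbitrary: k P)
  case 0
  show ?case by (simp add: recursive_rel_def recursive_fn_iff_recursive dec_def)
next
  case (Suc n)
  \<comment> \<open>Stated for arbitrary \<open>R\<close> and \<open>X\<close>, so that one argument
    covers \<open>pg n\<close> with \<open>Ex\<close> and \<open>sg n\<close> with
    \<open>All\<close>.\<close>
  have "(\<exists>Q. R (\<lambda>z. Q (dec_list (Suc k) z)) \<and> (\<forall>xs. length xs = Suc k \<longrightarrow> P xs = X (\<lambda>y. Q (y # xs))))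
    \<longleftrightarrow> (\<exists>Q. R Q \<and> (\<forall>x. P (dec_list k x) = X (\<lambda>y. Q (pr y x))))"
    for R :: "(nat \<Rightarrow> bool) \<Rightarrow> bool" and X :: "(nat \<Rightarrow> bool) \<Rightarrow> bool"
  proof
    assume "\<exists>Q. R (\<lambda>z. Q (dec_list (Suc k) z)) \<and>
      (\<forall>xs. length xs = Suc k \<longrightarrow> P xs = X (\<lambda>y. Q (y # xs)))"
    then obtain Q where Q: "R (\<lambda>z. Q (dec_list (Suc k) z))"
      "\<And>xs. length xs = Suc k \<Longrightarrow> P xs = X (\<lambda>y. Q (y # xs))"
      by blast
    then show "\<exists>Q. R Q \<and> (\<forall>x. P (dec_list k x) = X (\<lambda>y. Q (pr y x)))"
      by (intro exI[of _ "\<lambda>z. Q (dec_list (Suc k) z)"]) simp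
  next
    assume "\<exists>Q. R Q \<and> (\<forall>x. P (dec_list k x) = X (\<lambda>y. Q (pr y x)))"
    then obtain Q where Q: "R Q" "\<And>x. P (dec_list k x) = X (\<lambda>y. Q (pr y x))"
      by blast
    have "P xs = X (\<lambda>y. Q (enc_list (Suc k) (y # xs)))" if "length xs = Suc k" for xs
      using Q(2)[of "enc_list k xs"] that by simp
    moreover have "R (\<lambda>z. Q (enc_list (Suc k) (dec_list (Suc k) z)))"
      using Q(1) by (simp only: enc_dec_list)
    ultimately show "\<exists>Q. R (\<lambda>z. Q (dec_list (Suc k) z)) \<and>
        (\<forall>xs. length xs = Suc k \<longrightarrow> P xs = X (\<lambda>y. Q (y # xs)))"
      by (intro exI[of _ "\<lambda>xs. Q (enc_list (Suc k) xs)"]) blast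
  qed
  from this[of "pg n" Ex] this[of "sg n" All] show ?case
    using Suc.IH[of "Suc k"] by (simp add: sg_Suc pg_Suc)
qed

lemma Sigma0_iff_sg: "Sigma0 n A \<longleftrightarrow> sg n (\<lambda>x. x \<in> A)"
  using Sigma0_rel_Pi0_rel_iff[of n 0 "\<lambda>xs. xs ! 0 \<in> A"] by (simp add: Sigma0_def)

text \<open>Taking the least witness \<open>y\<close> is not enough above the decidable level: that
  all \<open>i < y\<close> fail is a condition of the wrong kind. By induction each failure has a
  unique witness of lower complexity, and the list of these is made part of the new witness.\<close>

lemma sg_unique_witness:
  assumes "sg (Suc n) P"
  shows "\<exists>Q. pg n Q \<and> (\<forall>x. P x \<longleftrightarrow> (\<exists>y. Q (pr y x))) \<and>
    (\<forall>x y y'. Q (pr y x) \<longrightarrow> Q (pr y' x) \<longrightarrow> y = y')"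
  using assms
proof (induction n arbitrary: P)
  case 0
  then obtain Q where Q: "dec Q" "\<And>x. P x \<longleftrightarrow> (\<exists>y. Q (pr y x))" by (auto simp: sg_Suc)
  let ?Q = "\<lambda>z. Q z \<and> (\<forall>i<p1 z. \<not> Q (pr i (p2 z)))"
  have "pg 0 ?Q" unfolding pg_0 by (intro rec_intros Q(1) dec_compose[OF Q(1)])
  moreover have "P x \<longleftrightarrow> (\<exists>y. ?Q (pr y x))" for x
    using exists_least_iff[of "\<lambda>y. Q (pr y x)"] by (simp add: Q(2))
  moreover have "y = y'" if "?Q (pr y x)" "?Q (pr y' x)" for x y y'
    using that by simp (metis linorder_neqE_nat)
  ultimately show ?case by blast
next
  case (Suc n)
  then obtain Q where Q: "pg (Suc n) Q" "\<And>x. P x \<longleftrightarrow> (\<exists>y. Q (pr y x))" by (auto simp: sg_Suc[of "Suc n"])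
  obtain R where R: "pg n R" "\<And>x. \<not> Q x \<longleftrightarrow> (\<exists>y. R (pr y x))"
    "\<And>x y y'. R (pr y x) \<Longrightarrow> R (pr y' x) \<Longrightarrow> y = y'"
    using Suc.IH[OF sg_not[OF Q(1)]] by blast
  \<comment> \<open>The first component is the least witness \<open>y\<close>; the second codes the
    list of the refutations of \<open>0, ..., y - 1\<close>.\<close>
  let ?Q = "\<lambda>z. Q (pr (p1 (p1 z)) (p2 z)) \<and> length_code (p2 (p1 z)) = p1 (p1 z) \<and>
    (\<forall>i<p1 (p1 z). R (pr (nth_code (p2 (p1 z)) i) (pr i (p2 z))))"
  have R': "pg (Suc n) R" using R(1) by (rule pg_mono) simp
  have "pg (Suc n) ?Q"
    by (intro hier_intros pg_dec rec_intros pg_ball_less pg_compose[OF Q(1)]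
        pg_compose[OF R'])
  moreover have "P x \<longleftrightarrow> (\<exists>y. ?Q (pr y x))" for x
  proof
    assume "P x"
    then obtain y where y: "Q (pr y x)" "\<And>i. i < y \<Longrightarrow> \<not> Q (pr i x)"
      using exists_least_iff[of "\<lambda>y. Q (pr y x)"] by (auto simp: Q(2))
    from y(2) have "\<forall>i. \<exists>v. i < y \<longrightarrow> R (pr v (pr i x))" by (simp add: R(2))
    then obtain w where w: "\<And>i. i < y \<Longrightarrow> R (pr (w i) (pr i x))" by metis
    obtain c where c: "length_code c = y" "\<forall>i<y. nth_code c i = w i"
      using ex_list_code by blast
    show "\<exists>y. ?Q (pr y x)"
      by (rule exI[of _ "pr y c"]) (use y(1) w c in auto)
  qed (auto simp: Q(2))
  moreover have "u = u'" if "?Q (pr u x)" "?Q (pr u' x)" for x u u'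
  proof -
    have u: "Q (pr (p1 u) x)" "length_code (p2 u) = p1 u"
      "\<And>i. i < p1 u \<Longrightarrow> R (pr (nth_code (p2 u) i) (pr i x))"
      and u': "Q (pr (p1 u') x)" "length_code (p2 u') = p1 u'"
      "\<And>i. i < p1 u' \<Longrightarrow> R (pr (nth_code (p2 u') i) (pr i x))"
      using that by auto
    \<comment> \<open>If one witness were smaller, the list attached to the larger one would refute
      it.\<close>
    have "\<not> p1 u < p1 u'" "\<not> p1 u' < p1 u"
      using u(1,3) u'(1,3) R(2) by blast+
    then have eq: "p1 u = p1 u'" by simp
    have "p2 u = p2 u'"
      by (rule list_code_eqI) (use u u' eq in \<open>auto intro: R(3)\<close>)
    with eq show ?thesis by (metis pr_p1_p2)
  qed
  ultimately show ?case by blast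
qed

subsection \<open>The upper bound\<close>

lemma pg2_set_eq:
  assumes "sg 1 (\<lambda>z. p1 z \<in> A (p2 z))" "sg 1 (\<lambda>z. p1 z \<in> B (p2 z))"
  shows "pg (Suc (Suc 0)) (\<lambda>x. A x = B x)"
proof -
  have "pg (Suc (Suc 0)) (\<lambda>x. \<forall>y. (y \<in> A x \<longrightarrow> y \<in> B x) \<and> (y \<in> B x \<longrightarrow> y \<in> A x))"
    by (intro pg_all hier_intros sg_mono[OF assms(1)] sg_mono[OF assms(2)]
        sg_imp_pg[OF assms(1)] sg_imp_pg[OF assms(2)]) simp_all
  moreover have "A x = B x \<longleftrightarrow> (\<forall>y. (y \<in> A x \<longrightarrow> y \<in> B x) \<and> (y \<in> B x \<longrightarrow> y \<in> A x))" for x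
    by blast
  ultimately show ?thesis by simp
qed

section \<open>Coding teaching sets and lengths of sequences by numbers\<close>

definition code_set :: "nat \<Rightarrow> nat \<Rightarrow> nat set" where
  "code_set d s = nth_code s ` {..<d}"

lemma ex_code_set:
  assumes "finite S"
  shows "\<exists>s. code_set (card S) s = S \<and> inj_on (nth_code s) {..<card S}"
proof -
  obtain h where h: "bij_betw h {..<card S} S"
    using ex_bij_betw_nat_finite[OF assms] by (auto simp: atLeast0LessThan)
  obtain s where s: "\<forall>i<card S. nth_code s i = h i"
    using ex_list_code by blast
  have "bij_betw (nth_code s) {..<card S} S"
    using bij_betw_cong[of "{..<card S}" "nth_code s" h S] h s by simp
  then show ?thesis
    by (auto simp: bij_betw_def code_set_def)
qed

text \<open>The code 0 stands for infinite length and \<open>Suc n\<close> for length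
  \<open>n\<close>.\<close>

definition is_index :: "nat \<Rightarrow> nat \<Rightarrow> bool" where
  "is_index c i \<longleftrightarrow> c = 0 \<or> Suc i < c"

lemma ex_indices_code: "\<exists>c. \<forall>i. i \<in> indices N \<longleftrightarrow> is_index c i"
proof (cases N)
  case (enat n)
  then show ?thesis by (intro exI[of _ "Suc n"]) (auto simp: indices_def is_index_def)
qed (intro exI[of _ 0], simp add: indices_def is_index_def)

lemma ex_indices_of_code: "\<exists>N. \<forall>i. i \<in> indices N \<longleftrightarrow> is_index c i"
proof (cases c)
  case (Suc n)
  then show ?thesis by (intro exI[of _ "enat n"]) (auto simp: indices_def is_index_def)
qed (intro exI[of _ \<infinity>], simp add: indices_def is_index_def)

lemma seq_order_finite_iff: "seq_order N d < \<infinity> \<longleftrightarrow> (\<exists>D. \<forall>i\<in>indices N. d i \<le> D)"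
proof
  assume "seq_order N d < \<infinity>"
  then obtain D where D: "seq_order N d = enat D" by auto
  have "enat (d i) \<le> enat D" if "i \<in> indices N" for i
    unfolding D[symmetric] seq_order_def using that by (rule SUP_upper)
  then show "\<exists>D. \<forall>i\<in>indices N. d i \<le> D" by auto
next
  assume "\<exists>D. \<forall>i\<in>indices N. d i \<le> D"
  then obtain D where "\<And>i. i \<in> indices N \<Longrightarrow> enat (d i) \<le> enat D" by auto
  then have "seq_order N d \<le> enat D" unfolding seq_order_def by (rule SUP_least)
  then show "seq_order N d < \<infinity>" by (rule le_less_trans) simp
qed

definition teaches :: "(nat \<Rightarrow> nat \<Rightarrow> nat set) \<Rightarrow> nat \<Rightarrow> nat \<Rightarrow> nat \<Rightarrow> nat set \<Rightarrow> bool" where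
  "teaches T c i j S \<longleftrightarrow> S \<subseteq> T i j \<and> (\<forall>i' j'. is_index c i' \<and> i \<le> i' \<longrightarrow> S \<subseteq> T i' j' \<longrightarrow> T i j = T i' j')"

text \<open>
  The variable \<open>z\<close> codes a list of languages \<open>nth_code z d\<close> of \<open>F i\<close>, one for each possible value \<open>d \<le> D\<close>
  of \<open>d i\<close>. A list on which no \<open>d\<close> works exists iff every \<open>d\<close> fails for some language: this moves the bounded
  quantifier over \<open>d\<close> behind the universal quantifier over the languages of \<open>F i\<close>.
\<close>

definition teaching_witness :: "(nat \<Rightarrow> nat set) \<Rightarrow> (nat \<Rightarrow> nat \<Rightarrow> nat set) \<Rightarrow> nat \<Rightarrow> nat \<Rightarrow> bool" where
  "teaching_witness L T c D \<longleftrightarrow>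
    (\<forall>i i' j j'. is_index c i \<and> is_index c i' \<and> i \<noteq> i' \<longrightarrow> T i j \<noteq> T i' j') \<and>
    (\<forall>i j. is_index c i \<longrightarrow> (\<exists>k. T i j = L k)) \<and>
    (\<forall>k. \<exists>i j. is_index c i \<and> T i j = L k) \<and>
    (\<forall>i z. is_index c i \<longrightarrow> (\<exists>d s. d \<le> D \<and> inj_on (nth_code s) {..<d} \<and>
       teaches T c i (nth_code z d) (code_set d s)))"

text \<open>The size \<open>d i\<close> must not depend on the language, whereas the last clause of
  \<open>teaching_witness\<close> lets \<open>d\<close> depend on the list \<open>z\<close>. A list
  of counterexamples, one for each size, bridges this gap.\<close>

lemma teaching_witness_iff:
  assumes I: "\<And>i. i \<in> indices N \<longleftrightarrow> is_index c i"
    and F: "\<And>i. i \<in> indices N \<Longrightarrow> F i = range (T i)"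
  shows "teaching_witness L T c D \<longleftrightarrow>
    (\<exists>d. positive_teaching_seq (range L) N F d \<and> (\<forall>i\<in>indices N. d i \<le> D))"
proof
  assume "teaching_witness L T c D"
  then have w1: "\<And>i i' j j'. is_index c i \<Longrightarrow> is_index c i' \<Longrightarrow> i \<noteq> i' \<Longrightarrow> T i j \<noteq> T i' j'"
    and w2: "\<And>i j. is_index c i \<Longrightarrow> \<exists>k. T i j = L k"
    and w3: "\<And>k. \<exists>i j. is_index c i \<and> T i j = L k"
    and w4: "\<And>i z. is_index c i \<Longrightarrow> \<exists>d s. d \<le> D \<and> inj_on (nth_code s) {..<d} \<and>
       teaches T c i (nth_code z d) (code_set d s)"
    unfolding teaching_witness_def by simp_all
  have "\<exists>d\<le>D. \<forall>j. \<exists>s. inj_on (nth_code s) {..<d} \<and> teaches T c i j (code_set d s)"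
    if i: "is_index c i" for i
  proof (rule ccontr)
    assume neg: "\<not> ?thesis"
    then have "\<forall>d. \<exists>j. d \<le> D \<longrightarrow> (\<forall>s. inj_on (nth_code s) {..<d} \<longrightarrow> \<not> teaches T c i j (code_set d s))"
      by blast
    then obtain j where j: "\<And>d s. d \<le> D \<Longrightarrow> inj_on (nth_code s) {..<d} \<Longrightarrow>
        \<not> teaches T c i (j d) (code_set d s)"
      by metis
    \<comment> \<open>\<open>Suc D\<close> entries, one for each size from 0 to
      \<open>D\<close>.\<close>
    obtain z where "\<forall>d<Suc D. nth_code z d = j d" using ex_list_code by blast
    moreover obtain d s where "d \<le> D" "inj_on (nth_code s) {..<d}"
      "teaches T c i (nth_code z d) (code_set d s)"
      using w4[OF i] by blast
    ultimately show False using j by (metis less_Suc_eq_le)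
  qed
  then obtain d where d: "\<And>i. is_index c i \<Longrightarrow> d i \<le> D"
    "\<And>i j. is_index c i \<Longrightarrow> \<exists>s. inj_on (nth_code s) {..<d i} \<and> teaches T c i j (code_set (d i) s)"
    by metis
  have "positive_teaching_seq (range L) N F d"
    unfolding positive_teaching_seq_def
  proof (intro conjI ballI)
    have "F i \<inter> F i' = {}" if "i \<in> indices N" "i' \<in> indices N" "i \<noteq> i'" for i i'
    proof -
      have "T i j \<noteq> T i' j'" for j j'
        using w1 that I by simp
      then show ?thesis using F that by auto
    qed
    then show "disjoint_family_on F (indices N)"
      by (simp add: disjoint_family_on_def)
    have "F i \<subseteq> range L" if i: "i \<in> indices N" for i
    proof -
      have "T i j \<in> range L" for j
      proof -
        obtain k where "T i j = L k"
          using w2[OF i[unfolded I]] by blast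
        then show ?thesis by simp
      qed
      then show ?thesis by (simp add: F[OF i] image_subset_iff)
    qed
    moreover have "\<exists>i\<in>indices N. L k \<in> F i" for k
    proof -
      obtain i j where "i \<in> indices N" "T i j = L k"
        using w3[of k] I by auto
      then show ?thesis using F by (metis rangeI)
    qed
    ultimately show "\<Union> (F ` indices N) = range L" by blast
  next
    fix i A assume i: "i \<in> indices N" and "A \<in> F i"
    then obtain j where A: "A = T i j" using F by auto
    obtain s where s: "inj_on (nth_code s) {..<d i}" "teaches T c i j (code_set (d i) s)"
      using d(2) i I by blast
    show "\<exists>S\<subseteq>A. finite S \<and> card S = d i \<and>
      (\<forall>L'\<in>\<Union> (F ` {j \<in> indices N. i \<le> j}). S \<subseteq> L' \<longrightarrow> A = L')"
    proof (intro exI conjI)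
      show "card (code_set (d i) s) = d i" "finite (code_set (d i) s)"
        using s(1) by (simp_all add: code_set_def card_image)
      show "code_set (d i) s \<subseteq> A"
        "\<forall>L'\<in>\<Union> (F ` {j \<in> indices N. i \<le> j}). code_set (d i) s \<subseteq> L' \<longrightarrow> A = L'"
        using s(2) by (auto simp: teaches_def A F I)
    qed
  qed (auto simp: F)
  then show "\<exists>d. positive_teaching_seq (range L) N F d \<and> (\<forall>i\<in>indices N. d i \<le> D)"
    using d(1) I by blast
next
  assume "\<exists>d. positive_teaching_seq (range L) N F d \<and> (\<forall>i\<in>indices N. d i \<le> D)"
  then obtain d where "positive_teaching_seq (range L) N F d" and D: "\<And>i. i \<in> indices N \<Longrightarrow> d i \<le> D"
    by blast
  then have disj_F: "disjoint_family_on F (indices N)"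
    and un: "\<Union> (F ` indices N) = range L"
    and ex_S: "\<And>i A. i \<in> indices N \<Longrightarrow> A \<in> F i \<Longrightarrow> \<exists>S\<subseteq>A. finite S \<and> card S = d i \<and>
      (\<forall>L'\<in>\<Union> (F ` {j \<in> indices N. i \<le> j}). S \<subseteq> L' \<longrightarrow> A = L')"
    unfolding positive_teaching_seq_def by simp_all
  have disj: "F i \<inter> F i' = {}" if "is_index c i" "is_index c i'" "i \<noteq> i'" for i i'
    by (rule disjoint_family_onD[OF disj_F]) (use that I in simp_all)
  have teach: "\<exists>s. inj_on (nth_code s) {..<d i} \<and> teaches T c i j (code_set (d i) s)"
    if i: "is_index c i" for i j
  proof -
    have "T i j \<in> F i" using F I i by simp
    from ex_S[OF i[folded I] this] obtain S where S: "S \<subseteq> T i j" "finite S" "card S = d i"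
      "\<forall>L'\<in>\<Union> (F ` {j \<in> indices N. i \<le> j}). S \<subseteq> L' \<longrightarrow> T i j = L'"
      by blast
    obtain s where "code_set (d i) s = S" "inj_on (nth_code s) {..<d i}"
      using ex_code_set[OF S(2)] S(3) by auto
    moreover have "teaches T c i j S"
      unfolding teaches_def
    proof (intro conjI allI impI S(1))
      fix i' j' assume "is_index c i' \<and> i \<le> i'" "S \<subseteq> T i' j'"
      then show "T i j = T i' j'" using S(4) F I by auto
    qed
    ultimately show ?thesis by auto
  qed
  show "teaching_witness L T c D"
    unfolding teaching_witness_def
  proof (intro conjI allI impI)
    fix i i' j j' assume "is_index c i \<and> is_index c i' \<and> i \<noteq> i'"
    then show "T i j \<noteq> T i' j'" using disj[of i i'] F I by auto
  next
    fix i j assume "is_index c i"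
    then have "i \<in> indices N" "T i j \<in> F i" using F I by auto
    then have "T i j \<in> \<Union> (F ` indices N)" by blast
    then show "\<exists>k. T i j = L k" unfolding un by blast
  next
    fix k
    have "L k \<in> \<Union> (F ` indices N)" using un by simp
    then obtain i where "i \<in> indices N" "L k \<in> F i" by blast
    moreover from this obtain j where "L k = T i j" using F by auto
    ultimately show "\<exists>i j. is_index c i \<and> T i j = L k" using I by metis
  next
    fix i z assume i: "is_index c i"
    then show "\<exists>da s. da \<le> D \<and> inj_on (nth_code s) {..<da} \<and>
        teaches T c i (nth_code z da) (code_set da s)"
      using teach[OF i, of "nth_code z (d i)"] D[of i] I by blast
  qed
qed

definition re_family :: "(nat \<Rightarrow> nat set) \<Rightarrow> nat \<Rightarrow> nat \<Rightarrow> nat \<Rightarrow> nat set" where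
  "re_family W v i j = {x. pr i (pr j x) \<in> W v}"

lemma RTD_plus_le: "positive_teaching_seq \<L> N F d \<Longrightarrow> RTD_plus \<L> \<le> seq_order N d"
  unfolding RTD_plus_def by (intro Inf_lower) blast

lemma uniformly_re_seq_index:
  assumes W: "range W = {A. re A}" and u: "uniformly_re_seq N F"
  shows "\<exists>v. \<forall>i\<in>indices N. F i = range (re_family W v i)"
proof -
  obtain V where "re V" and V: "\<forall>i\<in>indices N. F i = range (\<lambda>j. {x. pr i (pr j x) \<in> V})"
    using u unfolding uniformly_re_seq_def by blast
  moreover from \<open>re V\<close> obtain v where "V = W v" using W by blast
  ultimately show ?thesis unfolding re_family_def by blast
qed

text \<open>Sequence, length and order bound become the numbers \<open>v\<close>, \<open>c\<close>
  and \<open>D\<close>, so that the arithmetical quantifiers can be counted.\<close>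

lemma R_plus_ure_iff:
  assumes W: "range W = {A. re A}"
  shows "e \<in> R_plus_ure W \<longleftrightarrow> (\<exists>v c D. teaching_witness (lang W e) (re_family W v) c D)"
proof
  assume "e \<in> R_plus_ure W"
  then obtain N F d where p: "positive_teaching_seq (lang_family W e) N F d"
    and u: "uniformly_re_seq N F" and o: "seq_order N d < \<infinity>"
    unfolding R_plus_ure_def by blast
  obtain v where F: "\<And>i. i \<in> indices N \<Longrightarrow> F i = range (re_family W v i)"
    using uniformly_re_seq_index[OF W u] by blast
  obtain c where c: "\<And>i. i \<in> indices N \<longleftrightarrow> is_index c i" using ex_indices_code by blast
  show "\<exists>v c D. teaching_witness (lang W e) (re_family W v) c D"
    using teaching_witness_iff[of N c F "re_family W v", OF c F] p o
    unfolding seq_order_finite_iff lang_family_def by blast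
next
  assume "\<exists>v c D. teaching_witness (lang W e) (re_family W v) c D"
  then obtain v c D where w: "teaching_witness (lang W e) (re_family W v) c D" by blast
  obtain N where N: "\<And>i. i \<in> indices N \<longleftrightarrow> is_index c i" using ex_indices_of_code by blast
  let ?F = "\<lambda>i. range (re_family W v i)"
  obtain d where d: "positive_teaching_seq (lang_family W e) N ?F d" "\<forall>i\<in>indices N. d i \<le> D"
    using w teaching_witness_iff[of N c ?F "re_family W v", OF N refl]
    unfolding lang_family_def by blast
  have o: "seq_order N d < \<infinity>" using d(2) seq_order_finite_iff by blast
  have "re (W v)" using W by blast
  then have "uniformly_re_seq N ?F"
    unfolding uniformly_re_seq_def re_family_def by blast
  with d(1) o show "e \<in> R_plus_ure W"
    unfolding R_plus_ure_def using le_less_trans[OF RTD_plus_le[OF d(1)] o] by blast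
qed

lemma sg_mem_numbering:
  assumes "re {prod_encode (e, x) | e x. x \<in> W e}" "recursive f" "recursive g"
  shows "sg (Suc n) (\<lambda>x. g x \<in> W (f x))"
  using sg_mem[OF assms(1) recursive_pr[OF assms(2,3)], of n] by simp

text \<open>Equality of two enumerated languages is \<open>\<Pi>\<^sub>2\<close>, and so is
  \<open>teaches\<close>, since inclusion of a finite set is \<open>\<Sigma>\<^sub>1\<close>. The
  costliest clauses, that every language occurs and that every list has a working size, are
  universal over existential over \<open>\<Pi>\<^sub>2\<close>, hence
  \<open>\<Pi>\<^sub>4\<close>.\<close>

lemma Sigma0_R_plus_ure:
  assumes W: "range W = {A. re A}" and re_W: "re {prod_encode (e, x) | e x. x \<in> W e}"
  shows "Sigma0 5 (R_plus_ure W)"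
proof -
  note mem = sg_mem_numbering[OF re_W]
  have memT: "sg 1 (\<lambda>z. p1 z \<in> re_family W (v (p2 z)) (i (p2 z)) (j (p2 z)))"
    if "recursive v" "recursive i" "recursive j" for v i j
    unfolding re_family_def One_nat_def mem_Collect_eq
    by (intro mem rec_intros that[THEN recursive_compose])
  have eq: "pg (Suc (Suc 0)) (\<lambda>x. re_family W (v x) (i x) (j x) = B x)"
    if "recursive v" "recursive i" "recursive j" "sg 1 (\<lambda>z. p1 z \<in> B (p2 z))" for v i j B
  proof (rule pg2_set_eq)
    show "sg 1 (\<lambda>z. p1 z \<in> re_family W (v (p2 z)) (i (p2 z)) (j (p2 z)))"
      by (rule memT[OF that(1-3)])
  qed (rule that(4))
  have memL: "sg 1 (\<lambda>z. p1 z \<in> lang W (e (p2 z)) (k (p2 z)))"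
    if "recursive e" "recursive k" for e k
    unfolding lang_def One_nat_def mem_Collect_eq
    by (intro mem rec_intros that[THEN recursive_compose])
  have idx: "dec (\<lambda>x. is_index (c x) (i x))" if "recursive c" "recursive i" for c i
    unfolding is_index_def by (intro rec_intros that)
  have sub: "sg 1 (\<lambda>x. code_set (d x) (s x) \<subseteq> re_family W (v x) (i x) (j x))"
    if "recursive d" "recursive s" "recursive v" "recursive i" "recursive j" for d s v i j
  proof -
    have "sg 1 (\<lambda>x. \<forall>a<d x. pr (i x) (pr (j x) (nth_code (s x) a)) \<in> W (v x))"
      using that unfolding One_nat_def
      by (intro sg1_ball_less[unfolded One_nat_def] mem rec_intros that[THEN recursive_compose])
    moreover have "code_set (d x) (s x) \<subseteq> re_family W (v x) (i x) (j x) \<longleftrightarrow>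
        (\<forall>a<d x. pr (i x) (pr (j x) (nth_code (s x) a)) \<in> W (v x))" for x
      by (auto simp: code_set_def re_family_def)
    ultimately show ?thesis by simp
  qed
  have inj: "dec (\<lambda>x. inj_on (nth_code (s x)) {..<d x})" if "recursive s" "recursive d" for s d
  proof -
    have "dec (\<lambda>x. \<forall>a<d x. \<forall>b<d x. nth_code (s x) a = nth_code (s x) b \<longrightarrow> a = b)"
      by (intro rec_intros that[THEN recursive_compose] that)
    moreover have "inj_on (nth_code (s x)) {..<d x} \<longleftrightarrow>
        (\<forall>a<d x. \<forall>b<d x. nth_code (s x) a = nth_code (s x) b \<longrightarrow> a = b)" for x
      by (auto simp: inj_on_def)
    ultimately show ?thesis by (simp only:)
  qed
  have teach: "pg (Suc (Suc 0)) (\<lambda>x. teaches (re_family W (v x)) (c x) (i x) (j x) (code_set (d x) (s x)))"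
    if "recursive v" "recursive c" "recursive i" "recursive j" "recursive d" "recursive s" for v c i j d s
    unfolding teaches_def
  proof (rule pg_conj)
    show "pg (Suc (Suc 0)) (\<lambda>x. code_set (d x) (s x) \<subseteq> re_family W (v x) (i x) (j x))"
      by (rule sg_imp_pg[OF sub]) (simp_all add: that)
    note rec = rec_intros that[THEN recursive_compose]
    show "pg (Suc (Suc 0)) (\<lambda>x. \<forall>i' j'. is_index (c x) i' \<and> i x \<le> i' \<longrightarrow>
        code_set (d x) (s x) \<subseteq> re_family W (v x) i' j' \<longrightarrow>
        re_family W (v x) (i x) (j x) = re_family W (v x) i' j')"
    proof (rule pg_all, rule pg_all, rule pg_imp, goal_cases)
      case 1
      show ?case by (rule sg_dec) (intro rec idx)
    next
      case 2
      show ?case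
      proof (rule pg_imp, goal_cases)
        case 1
        show ?case by (rule sg_mono[OF sub]) (intro rec | simp)+
      next
        case 2
        show ?case by (rule eq; (rule memT)?; intro rec)
      qed
    qed
  qed
  \<comment> \<open>\<open>p\<close> packs \<open>v\<close>, \<open>c\<close> and \<open>D\<close>,
    so that a single existential quantifier stands in front.\<close>
  have "sg (Suc (Suc (Suc (Suc (Suc 0))))) (\<lambda>e. \<exists>p. teaching_witness (lang W e) (re_family W (p1 p))
      (p1 (p2 p)) (p2 (p2 p)))"
    unfolding teaching_witness_def
  proof (rule sg_ex, rule pg_imp_sg[OF _ lessI], intro pg_conj)
    let ?e = "\<lambda>z. p2 z" and ?v = "\<lambda>z. p1 (p1 z)" and ?c = "\<lambda>z. p1 (p2 (p1 z))"
      and ?D = "\<lambda>z. p2 (p2 (p1 z))"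
    show "pg (Suc (Suc (Suc (Suc 0)))) (\<lambda>z. \<forall>i i' j j'. is_index (?c z) i \<and> is_index (?c z) i' \<and> i \<noteq> i' \<longrightarrow>
        re_family W (?v z) i j \<noteq> re_family W (?v z) i' j')"
      by (rule pg_all, rule pg_all, rule pg_all, rule pg_all, rule pg_imp, rule sg_dec,
          (intro rec_intros idx)[1]) (rule sg_imp_pg[OF sg_not[OF eq]];
          (rule memT)?; (intro rec_intros | simp))
    show "pg (Suc (Suc (Suc (Suc 0)))) (\<lambda>z. \<forall>i j. is_index (?c z) i \<longrightarrow>
        (\<exists>k. re_family W (?v z) i j = lang W (?e z) k))"
      by (rule pg_all, rule pg_all, rule pg_imp, rule sg_dec,
          (intro rec_intros idx)[1]) (rule sg_imp_pg[OF sg_ex[OF pg_imp_sg_Suc[OF eq]]];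
          (rule memL)?; (intro rec_intros | simp))
    show "pg (Suc (Suc (Suc (Suc 0)))) (\<lambda>z. \<forall>k. \<exists>i j. is_index (?c z) i \<and>
        re_family W (?v z) i j = lang W (?e z) k)"
      by (rule pg_all, rule sg_imp_pg[of "Suc (Suc (Suc 0))"], rule sg_ex, rule sg_ex, rule sg_conj,
          rule sg_dec, (intro rec_intros idx)[1]) ((rule pg_imp_sg_Suc[OF eq];
          (rule memL)?; intro rec_intros), simp)
    show "pg (Suc (Suc (Suc (Suc 0)))) (\<lambda>z. \<forall>i y. is_index (?c z) i \<longrightarrow>
        (\<exists>d s. d \<le> ?D z \<and> inj_on (nth_code s) {..<d} \<and>
          teaches (re_family W (?v z)) (?c z) i (nth_code y d) (code_set d s)))"
      by (rule pg_all, rule pg_all, rule pg_imp, rule sg_dec, (intro rec_intros idx)[1],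
          rule sg_imp_pg[of "Suc (Suc (Suc 0))"], rule sg_ex, rule sg_ex, rule sg_conj, rule sg_dec,
          (intro rec_intros)[1], rule sg_conj, rule sg_dec)
        ((rule inj; intro rec_intros), (rule pg_imp_sg_Suc[OF teach]; intro rec_intros), simp)
  qed
  moreover have "(\<exists>p. teaching_witness (lang W e) (re_family W (p1 p)) (p1 (p2 p)) (p2 (p2 p))) \<longleftrightarrow>
      e \<in> R_plus_ure W" for e
    unfolding R_plus_ure_iff[OF W] by (metis p1_pr p2_pr)
  ultimately have "sg 5 (\<lambda>e. e \<in> R_plus_ure W)"
    by (simp add: eval_nat_numeral)
  then show ?thesis by (simp add: Sigma0_iff_sg)
qed

subsection \<open>Gadgets\<close>

text \<open>
  The bounds \<open>rho g c\<close> grow with \<open>c\<close>, and \<open>t\<^sub>c = sup {n. rho g c n}\<close> is a stage counter. The element \<open>Suc \<langle>c, s\<rangle>\<close>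
  separates \<open>approx_set g c\<close> from \<open>limit_set g\<close> while \<open>t\<^sub>c = s\<close>, and it enters \<open>limit_set g\<close> when \<open>t\<^sub>c\<close> increases. So
  the two sets coincide if \<open>t\<^sub>c = \<infinity>\<close>. The predicate \<open>K\<close> marks the collapsed gadgets.
\<close>

locale teaching_gadgets =
  fixes rho :: "nat \<Rightarrow> nat \<Rightarrow> nat \<Rightarrow> bool" and K :: "nat \<Rightarrow> bool"
  assumes rho_0: "rho g c 0"
    and rho_antimono: "m \<le> n \<Longrightarrow> rho g c n \<Longrightarrow> rho g c m"
    and rho_mono: "c \<le> c' \<Longrightarrow> rho g c n \<Longrightarrow> rho g c' n"
begin

definition limit_set :: "nat \<Rightarrow> nat set" where
  "limit_set g = {r. r = 0 \<or> K g \<or> (\<exists>c s. r = Suc (pr c s) \<and> rho g c (Suc s))}"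

definition approx_set :: "nat \<Rightarrow> nat \<Rightarrow> nat set" where
  "approx_set g c = {r. r = 0 \<or> K g \<or> (\<exists>s. r = Suc (pr c s) \<and> rho g c s) \<or>
     (r \<in> limit_set g \<and> (\<exists>n. rho g c n \<and> r < c + n))}"

definition gadget_set :: "nat \<Rightarrow> nat \<Rightarrow> nat set" where
  "gadget_set g k = (if k = 0 then limit_set g else approx_set g (k - 1))"

definition member :: "nat \<Rightarrow> nat set" where
  "member k = pr (p1 k) ` gadget_set (p1 k) (p2 k)"

definition failed :: "nat \<Rightarrow> bool" where
  "failed g \<longleftrightarrow> \<not> K g \<and> (\<forall>c. \<exists>n. \<not> rho g c n)"

lemma gadget_set_0 [simp]: "gadget_set g 0 = limit_set g"
  and gadget_set_Suc [simp]: "gadget_set g (Suc c) = approx_set g c"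
  by (simp_all add: gadget_set_def)

lemma zero_in_gadget_set [simp]: "0 \<in> limit_set g" "0 \<in> approx_set g c" "0 \<in> gadget_set g k"
  by (simp_all add: gadget_set_def limit_set_def approx_set_def)

lemma pr_in_member_iff [simp]: "pr g r \<in> member k \<longleftrightarrow> p1 k = g \<and> r \<in> gadget_set g (p2 k)"
  by (auto simp: member_def)

lemma gadget_set_collapsed: "K g \<Longrightarrow> gadget_set g k = UNIV"
  by (simp add: gadget_set_def limit_set_def approx_set_def)

lemma approx_set_full:
  assumes "\<And>n. rho g c n"
  shows "approx_set g c = limit_set g"
proof
  show "approx_set g c \<subseteq> limit_set g"
    using assms by (auto simp: approx_set_def limit_set_def)
  show "limit_set g \<subseteq> approx_set g c"
  proof
    fix r assume "r \<in> limit_set g"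
    moreover have "rho g c (Suc r) \<and> r < c + Suc r" using assms by simp
    ultimately show "r \<in> approx_set g c" unfolding approx_set_def by blast
  qed
qed

lemma rho_bound:
  assumes "\<not> rho g c n" "rho g c m"
  shows "m < n"
  using assms rho_antimono[of n m] by (meson not_less)

text \<open>At the final value \<open>t\<close> of the counter, \<open>Suc (pr c t)\<close> has
  entered the approximation but never enters the limit set. Other approximations could only receive
  it through the limit set.\<close>

lemma approx_set_own_element:
  assumes K: "\<not> K g" and n: "\<not> rho g c n"
  shows "\<exists>t. Suc (pr c t) \<in> approx_set g c - limit_set g \<and>
    (\<forall>c'. Suc (pr c t) \<in> approx_set g c' \<longrightarrow> c' = c)"
proof -
  define t where "t = (GREATEST m. rho g c m)"
  have bound: "\<And>m. rho g c m \<Longrightarrow> m \<le> n" using rho_bound[OF n] by (simp add: less_imp_le)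
  have t: "rho g c t" unfolding t_def by (rule GreatestI_nat[where P = "rho g c", OF rho_0 bound])
  have "\<not> rho g c (Suc t)"
  proof
    assume "rho g c (Suc t)"
    then have "Suc t \<le> t" unfolding t_def by (rule Greatest_le_nat[where P = "rho g c", OF _ bound])
    then show False by simp
  qed
  then have "Suc (pr c t) \<notin> limit_set g" using K by (auto simp: limit_set_def)
  then show ?thesis using K t by (intro exI[of _ t]) (auto simp: approx_set_def)
qed

lemma finite_approx_set:
  assumes K: "\<not> K g" and n: "\<not> rho g c n"
  shows "finite (approx_set g c)"
proof (rule finite_subset)
  show "approx_set g c \<subseteq> {0} \<union> (\<lambda>s. Suc (pr c s)) ` {..<n} \<union> {..<c + n}"
    using K rho_bound[OF n] by (auto simp: approx_set_def) (meson add_left_mono less_imp_le less_le_trans)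
qed simp

text \<open>By \<open>rho_mono\<close> all approximations from \<open>c0\<close> on equal the limit
  set. The exceptions are finitely many finite sets, whereas the limit set contains every
  \<open>Suc (pr c0 s)\<close> and is infinite.\<close>

lemma limit_set_separated:
  assumes K: "\<not> K g" and c0: "\<And>n. rho g c0 n"
  shows "\<exists>r\<in>limit_set g. \<forall>c. r \<in> approx_set g c \<longrightarrow> approx_set g c = limit_set g"
proof -
  let ?A = "\<Union> (approx_set g ` {c \<in> {..<c0}. \<exists>n. \<not> rho g c n})"
  have "finite ?A" using finite_approx_set[OF K] by auto
  moreover have "range (\<lambda>s. Suc (pr c0 s)) \<subseteq> limit_set g"
    using c0 by (auto simp: limit_set_def)
  moreover have "infinite (range (\<lambda>s. Suc (pr c0 s)))"
    by (intro range_inj_infinite injI) simp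
  ultimately obtain r where r: "r \<in> limit_set g" "r \<notin> ?A"
    by (meson infinite_super finite_subset subsetI)
  have "approx_set g c = limit_set g" if "r \<in> approx_set g c" for c
  proof (rule approx_set_full)
    fix n show "rho g c n"
      using that r(2) c0 rho_mono[of c0 c] by (cases "c < c0") auto
  qed
  with r(1) show ?thesis by blast
qed

text \<open>In a collapsed gadget all sets coincide. Otherwise a set equal to the limit set belongs
  to a gadget with an infinite counter, and any other set is an approximation with an element of its
  own.\<close>

lemma gadget_set_separated:
  assumes "\<not> (failed g \<and> k = 0)"
  shows "\<exists>r\<in>gadget_set g k. \<forall>k'. r \<in> gadget_set g k' \<longrightarrow> gadget_set g k' = gadget_set g k"
proof (cases "K g")
  case True
  then show ?thesis by (simp add: gadget_set_collapsed)
next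
  case K: False
  show ?thesis
  proof (cases "gadget_set g k = limit_set g")
    case True
    have "\<not> failed g"
    proof
      assume "failed g"
      with assms obtain c n where "k = Suc c" "\<not> rho g c n"
        unfolding failed_def by (metis not0_implies_Suc)
      with approx_set_own_element[OF K, of c n] True show False by auto
    qed
    with K obtain c0 where "\<And>n. rho g c0 n" by (auto simp: failed_def)
    from limit_set_separated[OF K this] show ?thesis
      unfolding True by (auto simp: gadget_set_def)
  next
    case False
    then obtain c where k: "k = Suc c" by (cases k) auto
    with False approx_set_full[of g c] obtain n where "\<not> rho g c n" by auto
    from approx_set_own_element[OF K this] obtain t
      where t: "Suc (pr c t) \<in> approx_set g c - limit_set g"
        "\<And>c'. Suc (pr c t) \<in> approx_set g c' \<Longrightarrow> c' = c"
      by blast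
    show ?thesis
    proof (intro bexI[of _ "Suc (pr c t)"] allI impI)
      fix k' assume "Suc (pr c t) \<in> gadget_set g k'"
      with t show "gadget_set g k' = gadget_set g k" by (cases k') (auto simp: k)
    qed (use t(1) k in simp)
  qed
qed

lemma member_separated:
  assumes "\<not> (failed (p1 k) \<and> p2 k = 0)"
  shows "\<exists>y\<in>member k. \<forall>k'. y \<in> member k' \<longrightarrow> member k' = member k"
proof -
  obtain r where r: "r \<in> gadget_set (p1 k) (p2 k)"
    and sep: "\<forall>k'. r \<in> gadget_set (p1 k) k' \<longrightarrow> gadget_set (p1 k) k' = gadget_set (p1 k) (p2 k)"
    using gadget_set_separated[OF assms] by (elim bexE)
  show ?thesis
  proof (intro bexI[of _ "pr (p1 k) r"] allI impI)
    fix k' assume "pr (p1 k) r \<in> member k'"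
    then have "p1 k' = p1 k" "r \<in> gadget_set (p1 k) (p2 k')" by simp_all
    then show "member k' = member k" using sep by (simp add: member_def)
  qed (simp add: r)
qed

lemma failed_approx_set_neq: "failed g \<Longrightarrow> approx_set g c \<noteq> limit_set g"
  using approx_set_own_element unfolding failed_def by blast

text \<open>Two blocks suffice: first all sets covered by \<open>member_separated\<close>, then the
  limit sets of the failed gadgets, which \<open>pr g 0\<close> identifies once the approximations
  are gone. Finiteness makes the re-indexing \<open>f\<close> recursive.\<close>

lemma finitely_many_failed_imp_teachable:
  assumes fin: "finite {g. failed g}" and re: "re {pr k y | k y. y \<in> member k}"
  shows "\<exists>N F d. positive_teaching_seq (range member) N F d \<and> uniformly_re_seq N F \<and>
    seq_order N d < \<infinity>"
proof -
  let ?B = "{g. failed g}"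
  define b where "b = (SOME g. failed g)"
  \<comment> \<open>In block 0 the index of the limit set of a failed gadget is redirected to
    \<open>pr g 1\<close>, the index of \<open>approx_set g 0\<close>. Block 1 lists the limit sets
    of the failed gadgets, with \<open>b\<close> as default.\<close>
  define f where "f = (\<lambda>(i::nat) k. if i = 0 then if p1 k \<in> ?B \<and> p2 k = 0 then pr (p1 k) 1 else k
    else pr (if k \<in> ?B then k else b) 0)"
  define F where "F = (\<lambda>i. range (\<lambda>k. member (f i k)))"
  \<comment> \<open>Without failed gadgets the second block would have nothing to list, so the
    length drops to 1.\<close>
  define N where "N = enat (if ?B = {} then 1 else 2)"
  have "indices N = {..<if ?B = {} then 1 else 2}" by (simp add: indices_def N_def lessThan_def)
  moreover have "{..<2} = {0, 1 :: nat}" "{..<1} = {0 :: nat}" by auto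
  ultimately have ind: "indices N = (if ?B = {} then {0} else {0, 1})" by simp
  have b: "failed b" if "1 \<in> indices N"
    using that unfolding b_def by (intro someI_ex[of failed]) (auto simp: ind split: if_splits)
  have f0: "\<not> (failed (p1 (f 0 k)) \<and> p2 (f 0 k) = 0)" for k
    by (simp add: f_def)
  have f1: "\<exists>g. failed g \<and> f 1 k = pr g 0" if "1 \<in> indices N" for k
    using b[OF that] by (auto simp: f_def)
  have "positive_teaching_seq (range member) N F (\<lambda>_. 1)"
    unfolding positive_teaching_seq_def
  proof (intro conjI ballI)
    have F01: "F 0 \<inter> F 1 = {}" if "1 \<in> indices N"
    proof -
      have "member (f 0 k) \<noteq> member (f 1 k')" for k k'
      proof
        assume eq: "member (f 0 k) = member (f 1 k')"
        obtain g where g: "failed g" "f 1 k' = pr g 0" using f1[OF \<open>1 \<in> indices N\<close>] by blast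
        have iff: "r \<in> limit_set g \<longleftrightarrow> p1 (f 0 k) = g \<and> r \<in> gadget_set (p1 (f 0 k)) (p2 (f 0 k))" for r
          using arg_cong[OF eq, of "\<lambda>A. pr g r \<in> A"] g(2) by auto
        \<comment> \<open>0 lies in every limit set, so its tagged copy reveals the gadget.\<close>
        have p1: "p1 (f 0 k) = g" using iff[of 0] by (simp add: limit_set_def)
        with iff have "limit_set g = gadget_set g (p2 (f 0 k))" by (simp add: set_eq_iff)
        moreover obtain c where "p2 (f 0 k) = Suc c"
          using f0[of k] g(1) p1 by (cases "p2 (f 0 k)") simp_all
        ultimately show False using failed_approx_set_neq[OF g(1), of c] by simp
      qed
      then show ?thesis by (auto simp: F_def)
    qed
    show "disjoint_family_on F (indices N)"
      unfolding disjoint_family_on_def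
    proof (intro ballI impI)
      fix i j assume "i \<in> indices N" "j \<in> indices N" "i \<noteq> j"
      then have "1 \<in> indices N" "i = 0 \<and> j = 1 \<or> i = 1 \<and> j = 0"
        by (auto simp: ind split: if_splits)
      with F01 show "F i \<inter> F j = {}" by (metis Int_commute)
    qed
    have "\<exists>i\<in>indices N. member k \<in> F i" for k
    proof (cases "p1 k \<in> ?B \<and> p2 k = 0")
      case True
      then have "k = f 1 (p1 k)" unfolding f_def by (metis One_nat_def pr_p1_p2 zero_neq_one)
      then have "member k \<in> F 1"
        unfolding F_def by (intro range_eqI[of _ _ "p1 k"] arg_cong[of _ _ member])
      moreover have "1 \<in> indices N" using True by (auto simp: ind)
      ultimately show ?thesis by blast
    next
      case False
      then have "k = f 0 k" by (auto simp: f_def)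
      then have "member k \<in> F 0"
        unfolding F_def by (intro range_eqI[of _ _ k] arg_cong[of _ _ member])
      moreover have "0 \<in> indices N" by (simp add: ind)
      ultimately show ?thesis by blast
    qed
    then show "\<Union> (F ` indices N) = range member" by (auto simp: F_def)
  next
    fix i L assume i: "i \<in> indices N" and "L \<in> F i"
    then obtain k where L: "L = member (f i k)" by (auto simp: F_def)
    have "\<exists>y\<in>L. \<forall>j\<in>indices N. i \<le> j \<longrightarrow> (\<forall>L'\<in>F j. y \<in> L' \<longrightarrow> L = L')"
    proof (cases "i = 0")
      case True
      with member_separated[OF f0[of k]] show ?thesis by (auto simp: L F_def)
    next
      case False
      with i have i1: "i = 1" and one: "1 \<in> indices N" by (auto simp: ind split: if_splits)
      obtain g where g: "f (Suc 0) k = pr g 0" using f1[OF one] by auto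
      show ?thesis
      proof (intro bexI[of _ "pr g 0"] ballI impI)
        show "pr g 0 \<in> L" by (simp add: L i1 g limit_set_def)
        fix j L' assume j: "j \<in> indices N" "i \<le> j" and L': "L' \<in> F j" "pr g 0 \<in> L'"
        from j i1 have "j = 1" by (auto simp: ind split: if_splits)
        with L' obtain k' where k': "L' = member (f 1 k')" by (auto simp: F_def)
        obtain g' where "f (Suc 0) k' = pr g' 0" using f1[OF one] by auto
        with L'(2) k' g show "L = L'" by (simp add: L i1)
      qed
    qed
    then obtain y where "y \<in> L" "\<And>j L'. j \<in> indices N \<Longrightarrow> i \<le> j \<Longrightarrow> L' \<in> F j \<Longrightarrow> y \<in> L' \<Longrightarrow> L = L'"
      by blast
    then show "\<exists>S\<subseteq>L. finite S \<and> card S = 1 \<and>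
        (\<forall>L'\<in>\<Union> (F ` {j \<in> indices N. i \<le> j}). S \<subseteq> L' \<longrightarrow> L = L')"
      by (intro exI[of _ "{y}"]) auto
  qed (simp add: F_def)
  moreover have "uniformly_re_seq N F"
  proof -
    let ?h = "\<lambda>z. pr (f (p1 z) (p1 (p2 z))) (p2 (p2 z))"
    let ?V = "{z. ?h z \<in> {pr k y | k y. y \<in> member k}}"
    have "recursive ?h"
      unfolding f_def by (intro rec_intros dec_compose[OF dec_finite[OF fin]])
    then have "re ?V"
      using sg_mem[OF re, of ?h 0] by (simp add: re_iff_sg)
    moreover have "{x. pr i (pr k x) \<in> ?V} = member (f i k)" for i k
      by auto
    ultimately show ?thesis
      unfolding uniformly_re_seq_def F_def by (intro exI[of _ ?V]) simp
  qed
  moreover have "seq_order N (\<lambda>_. 1) < \<infinity>"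
    unfolding seq_order_finite_iff by blast
  ultimately show ?thesis by blast
qed

text \<open>If the gadget collapses, its only set lies in two disjoint blocks. If not, the limit set
  and all approximations share a block; every finite subset of the limit set is contained in an
  approximation, which still differs from the limit set.\<close>

lemma unfulfilled_imp_not_teaching_seq:
  assumes rho: "\<And>c. \<exists>n. \<not> rho g c n"
    and K: "K g \<longleftrightarrow> (\<exists>i\<in>indices N. \<exists>i'\<in>indices N. i \<noteq> i' \<and>
      (\<exists>A\<in>F i. \<exists>A'\<in>F i'. \<exists>r r'. pr g r \<in> A \<and> pr g r' \<in> A'))"
  shows "\<not> positive_teaching_seq (range member) N F d"
proof
  assume p: "positive_teaching_seq (range member) N F d"
  then have un: "\<Union> (F ` indices N) = range member"
    and disj: "disjoint_family_on F (indices N)"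
    and ex_S: "\<And>i L. i \<in> indices N \<Longrightarrow> L \<in> F i \<Longrightarrow> \<exists>S\<subseteq>L. finite S \<and> card S = d i \<and>
      (\<forall>L'\<in>\<Union> (F ` {j \<in> indices N. i \<le> j}). S \<subseteq> L' \<longrightarrow> L = L')"
    unfolding positive_teaching_seq_def by simp_all
  show False
  proof (cases "K g")
    case True
    then obtain i i' A A' r r' where A: "i \<in> indices N" "i' \<in> indices N" "i \<noteq> i'"
      "A \<in> F i" "A' \<in> F i'" "pr g r \<in> A" "pr g r' \<in> A'"
      using K by blast
    then have "A \<in> range member" "A' \<in> range member" using un by blast+
    then obtain k k' where k: "A = member k" "A' = member k'" by blast
    with A(6,7) have "p1 k = g" "p1 k' = g" by simp_all
    then have "A = A'" using True by (simp add: k member_def gadget_set_collapsed)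
    with A(4,5) disjoint_family_onD[OF disj A(1-3)] show False by blast
  next
    case False
    then have "failed g" using rho by (simp add: failed_def)
    obtain i where i: "i \<in> indices N" "member (pr g 0) \<in> F i" using un by blast
    from ex_S[OF this] obtain S where S: "S \<subseteq> member (pr g 0)" "finite S"
      "\<forall>L'\<in>\<Union> (F ` {j \<in> indices N. i \<le> j}). S \<subseteq> L' \<longrightarrow> member (pr g 0) = L'"
      by blast
    \<comment> \<open>Elements of \<open>S\<close> have the form \<open>pr g r\<close> with
      \<open>r < c\<close>; the clause with \<open>n = 0\<close> puts them into approximation
      \<open>c\<close>.\<close>
    obtain c where c: "\<And>y. y \<in> S \<Longrightarrow> p2 y < c"
      using finite_nat_set_iff_bounded[of "p2 ` S"] S(2) by auto
    obtain i' where i': "i' \<in> indices N" "member (pr g (Suc c)) \<in> F i'" using un by blast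
    have "i = i'"
    proof (rule ccontr)
      assume neq: "i \<noteq> i'"
      have "K g"
        unfolding K
        by (rule bexI[OF _ i(1)], rule bexI[OF _ i'(1)], rule conjI[OF neq],
            rule bexI[OF _ i(2)], rule bexI[OF _ i'(2)], intro exI[of _ 0]) simp
      with False show False by blast
    qed
    moreover have "S \<subseteq> member (pr g (Suc c))"
    proof
      fix y assume "y \<in> S"
      moreover from this S(1) obtain r where "y = pr g r" "r \<in> limit_set g"
        by (auto simp: member_def)
      ultimately show "y \<in> member (pr g (Suc c))"
        using c[of y] rho_0[of g c] by (auto simp: approx_set_def)
    qed
    ultimately have "member (pr g 0) = member (pr g (Suc c))"
      using S(3) i' by blast
    then have "pr g r \<in> member (pr g 0) \<longleftrightarrow> pr g r \<in> member (pr g (Suc c))" for r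
      by simp
    then have "approx_set g c = limit_set g" by auto
    with failed_approx_set_neq[OF \<open>failed g\<close>] show False by blast
  qed
qed

end

section \<open>From a \<open>\<Sigma>\<^sub>5\<close> set to a \<open>\<Pi>\<^sub>3\<close>
  condition on gadgets\<close>

lemma Sigma5_finitely_many_Pi3:
  assumes "Sigma0 5 B"
  shows "\<exists>P. pg 3 P \<and> (\<forall>x. x \<notin> B \<longrightarrow> (\<forall>w. \<exists>b. P (pr (pr w b) x))) \<and>
    (\<forall>x\<in>B. finite {g. P (pr g x)})"
proof -
  have "sg (Suc 4) (\<lambda>x. x \<in> B)" using assms by (simp add: Sigma0_iff_sg eval_nat_numeral)
  then obtain Q where Q: "pg 4 Q" "\<And>x. x \<in> B \<longleftrightarrow> (\<exists>a. Q (pr a x))" unfolding sg_Suc by blast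
  have "sg (Suc 3) (\<lambda>z. \<not> Q z)" using sg_not[OF Q(1)] by (simp add: eval_nat_numeral)
  then obtain R where R: "pg 3 R" "\<And>z. \<not> Q z \<longleftrightarrow> (\<exists>b. R (pr b z))"
    "\<And>z b b'. R (pr b z) \<Longrightarrow> R (pr b' z) \<Longrightarrow> b = b'"
    using sg_unique_witness by blast
  \<comment> \<open>For \<open>g = pr w b\<close>, the code \<open>b\<close> must list the unique
    witnesses that \<open>Q (pr a x)\<close> fails, for \<open>a = 0, ..., w\<close>.\<close>
  let ?P = "\<lambda>z. length_code (p2 (p1 z)) = Suc (p1 (p1 z)) \<and>
    (\<forall>a<Suc (p1 (p1 z)). R (pr (nth_code (p2 (p1 z)) a) (pr a (p2 z))))"
  have R3: "pg (Suc (Suc (Suc 0))) R" using R(1) by (simp add: eval_nat_numeral)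
  have "pg (Suc (Suc (Suc 0))) ?P"
    by (intro pg_conj pg_dec rec_intros pg_ball_less pg_compose[OF R3])
  then have "pg 3 ?P" by (simp only: eval_nat_numeral BitM.simps)
  moreover have "\<exists>b. ?P (pr (pr w b) x)" if "x \<notin> B" for x w
  proof -
    have "\<forall>a. \<exists>v. R (pr v (pr a x))" using that by (simp add: Q(2) R(2)[symmetric])
    then obtain v where v: "\<And>a. R (pr (v a) (pr a x))" by metis
    obtain b where "length_code b = Suc w" "\<forall>a<Suc w. nth_code b a = v a"
      using ex_list_code by blast
    with v show ?thesis by (intro exI[of _ b]) simp
  qed
  moreover have "finite {g. ?P (pr g x)}" if "x \<in> B" for x
  proof (rule finite_imageD)
    obtain a where a: "Q (pr a x)" using \<open>x \<in> B\<close> Q(2) by blast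
    \<comment> \<open>A list reaching position \<open>a\<close> would refute the true
      \<open>Q (pr a x)\<close>. Since uniqueness determines the list from \<open>p1 g\<close>, only
      finitely many \<open>g\<close> remain.\<close>
    have "p1 g < a" if g: "?P (pr g x)" for g
    proof (rule ccontr)
      assume "\<not> p1 g < a"
      with g have "R (pr (nth_code (p2 g) a) (pr a x))" by simp
      with a R(2) show False by blast
    qed
    then have "p1 ` {g. ?P (pr g x)} \<subseteq> {..<a}"
      by (intro image_subsetI) (simp only: mem_Collect_eq lessThan_iff)
    then show "finite (p1 ` {g. ?P (pr g x)})"
      by (rule finite_subset) simp
    show "inj_on p1 {g. ?P (pr g x)}"
    proof (rule inj_onI)
      fix g g' assume g: "g \<in> {g. ?P (pr g x)}" "g' \<in> {g. ?P (pr g x)}" and eq: "p1 g = p1 g'"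
      have "p2 g = p2 g'"
      proof (rule list_code_eqI)
        show "length_code (p2 g) = length_code (p2 g')" using g eq by simp
        fix a assume "a < length_code (p2 g)"
        then have "R (pr (nth_code (p2 g) a) (pr a x))" "R (pr (nth_code (p2 g') a) (pr a x))"
          using g eq by simp_all
        then show "nth_code (p2 g) a = nth_code (p2 g') a" by (rule R(3))
      qed
      with eq show "g = g'" by (metis pr_p1_p2)
    qed
  qed
  ultimately show ?thesis by blast
qed

subsection \<open>The reduction\<close>

text \<open>\<open>g\<close> is read as \<open>pr (pr v c) b\<close>, where \<open>v\<close> indexes
  a potential sequence and \<open>c\<close> codes its length. The predicate mentions neither the
  input \<open>x\<close> nor the family under construction, so there is no circularity.\<close>

definition collapsed :: "(nat \<Rightarrow> nat set) \<Rightarrow> nat \<Rightarrow> bool" where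
  "collapsed W g \<longleftrightarrow> (\<exists>i i' j j' r r'. is_index (p2 (p1 g)) i \<and> is_index (p2 (p1 g)) i' \<and> i \<noteq> i' \<and>
     pr g r \<in> re_family W (p1 (p1 g)) i j \<and> pr g r' \<in> re_family W (p1 (p1 g)) i' j')"

lemma sg1_collapsed:
  assumes re_W: "re {prod_encode (e, x) | e x. x \<in> W e}"
  shows "sg 1 (collapsed W)"
proof -
  have "sg (Suc 0) (\<lambda>g. collapsed W g)"
    unfolding collapsed_def is_index_def re_family_def mem_Collect_eq
    by (rule sg_ex, rule sg_ex, rule sg_ex, rule sg_ex, rule sg_ex, rule sg_ex, rule sg_conj, rule sg_dec,
        (intro rec_intros)[1], rule sg_conj, rule sg_dec, (intro rec_intros)[1], rule sg_conj,
        rule sg_dec, (intro rec_intros)[1], rule sg_conj)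
      (rule sg_mem_numbering[OF re_W]; intro rec_intros)+
  then show ?thesis by simp
qed

lemma collapsed_iff:
  assumes g: "p1 (p1 g) = v" "p2 (p1 g) = c"
    and I: "\<And>i. i \<in> indices N \<longleftrightarrow> is_index c i"
    and F: "\<And>i. i \<in> indices N \<Longrightarrow> F i = range (re_family W v i)"
  shows "collapsed W g \<longleftrightarrow> (\<exists>i\<in>indices N. \<exists>i'\<in>indices N. i \<noteq> i' \<and>
      (\<exists>A\<in>F i. \<exists>A'\<in>F i'. \<exists>r r'. pr g r \<in> A \<and> pr g r' \<in> A'))"
proof
  assume "collapsed W g"
  then obtain i i' j j' r r' where i: "i \<in> indices N" "i' \<in> indices N" "i \<noteq> i'"
    and r: "pr g r \<in> re_family W v i j" "pr g r' \<in> re_family W v i' j'"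
    unfolding collapsed_def g I by blast
  moreover have "re_family W v i j \<in> F i" "re_family W v i' j' \<in> F i'"
    using F i by simp_all
  ultimately show "\<exists>i\<in>indices N. \<exists>i'\<in>indices N. i \<noteq> i' \<and>
      (\<exists>A\<in>F i. \<exists>A'\<in>F i'. \<exists>r r'. pr g r \<in> A \<and> pr g r' \<in> A')"
    by blast
next
  assume "\<exists>i\<in>indices N. \<exists>i'\<in>indices N. i \<noteq> i' \<and>
      (\<exists>A\<in>F i. \<exists>A'\<in>F i'. \<exists>r r'. pr g r \<in> A \<and> pr g r' \<in> A')"
  then obtain i i' A A' r r' where i: "i \<in> indices N" "i' \<in> indices N" "i \<noteq> i'"
    and A: "A \<in> F i" "A' \<in> F i'" "pr g r \<in> A" "pr g r' \<in> A'"
    by blast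
  moreover from A(1,2) obtain j j' where "A = re_family W v i j" "A' = re_family W v i' j'"
    using F i by auto
  ultimately show "collapsed W g"
    unfolding collapsed_def g I by blast
qed

text \<open>Allowing all \<open>c' \<le> c\<close> makes the counter monotone in \<open>c\<close>,
  and testing an initial segment of \<open>n'\<close> makes it antimonotone in \<open>n\<close>, as
  the locale requires.\<close>

definition rho_of :: "(nat \<Rightarrow> bool) \<Rightarrow> nat \<Rightarrow> nat \<Rightarrow> nat \<Rightarrow> nat \<Rightarrow> bool" where
  "rho_of R x g c n \<longleftrightarrow> (\<exists>c'<Suc c. \<forall>n'<n. R (pr n' (pr c' (pr g x))))"

lemma teaching_gadgets_rho_of: "teaching_gadgets (rho_of R x)"
proof
  show "rho_of R x g c 0" for g c by (auto simp: rho_of_def)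
  show "rho_of R x g c m" if "m \<le> n" "rho_of R x g c n" for m n g c
    using that unfolding rho_of_def by (meson less_le_trans)
  show "rho_of R x g c' n" if "c \<le> c'" "rho_of R x g c n" for c c' g n
    using that unfolding rho_of_def by (meson Suc_le_mono less_le_trans)
qed

text \<open>For fixed \<open>c\<close> only finitely many \<open>c'\<close> compete, so a bound
  beyond all their counterexamples refutes \<open>rho_of\<close>.\<close>

lemma rho_of_bounded_iff:
  "(\<forall>c. \<exists>n. \<not> rho_of R x g c n) \<longleftrightarrow> (\<forall>c. \<exists>n. \<not> R (pr n (pr c (pr g x))))"
proof
  assume "\<forall>c. \<exists>n. \<not> rho_of R x g c n"
  then show "\<forall>c. \<exists>n. \<not> R (pr n (pr c (pr g x)))"
    unfolding rho_of_def by blast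
next
  assume "\<forall>c. \<exists>n. \<not> R (pr n (pr c (pr g x)))"
  then obtain h where h: "\<And>c. \<not> R (pr (h c) (pr c (pr g x)))" by metis
  show "\<forall>c. \<exists>n. \<not> rho_of R x g c n"
  proof
    fix c
    have "h c' < Suc (Max (h ` {..<Suc c}))" if "c' < Suc c" for c'
      using that by (simp add: less_Suc_eq_le)
    with h have "\<not> rho_of R x g c (Suc (Max (h ` {..<Suc c})))"
      unfolding rho_of_def by blast
    then show "\<exists>n. \<not> rho_of R x g c n" ..
  qed
qed

lemma sg1_rho_of:
  assumes R: "sg 1 R" and rec: "recursive x" "recursive g" "recursive c" "recursive n"
  shows "sg (Suc 0) (\<lambda>z. rho_of R (x z) (g z) (c z) (n z))"
proof -
  have R': "sg (Suc 0) R" using R by simp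
  show ?thesis
    unfolding rho_of_def
    by (rule sg_bex_less, intro rec_intros rec(3), rule sg1_ball_less[unfolded One_nat_def])
      (intro rec_intros sg_compose[OF R'] rec[THEN recursive_compose])+
qed

abbreviation gadget_member :: "(nat \<Rightarrow> nat set) \<Rightarrow> (nat \<Rightarrow> bool) \<Rightarrow> nat \<Rightarrow> nat \<Rightarrow> nat set" where
  "gadget_member W R x \<equiv> teaching_gadgets.member (rho_of R x) (collapsed W)"

lemma re_gadget_member:
  assumes R: "sg 1 R" and re_W: "re {prod_encode (e, x) | e x. x \<in> W e}"
  shows "re {z. p2 (p2 z) \<in> gadget_member W R (p1 z) (p1 (p2 z))}"
proof -
  have K: "sg (Suc 0) (\<lambda>z. collapsed W (g z))" if "recursive g" for g
    using sg_compose[OF sg1_collapsed[OF re_W] that] by simp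
  have lim: "sg (Suc 0) (\<lambda>z. r z \<in> teaching_gadgets.limit_set (rho_of R (x z)) (collapsed W) (g z))"
    if "recursive r" "recursive x" "recursive g" for r x g
    unfolding teaching_gadgets.limit_set_def[OF teaching_gadgets_rho_of] mem_Collect_eq
    by (intro sg_disj sg_conj sg_ex K sg1_rho_of[OF R] sg_dec rec_intros that
        that[THEN recursive_compose])
  have app: "sg (Suc 0) (\<lambda>z. r z \<in> teaching_gadgets.approx_set (rho_of R (x z)) (collapsed W) (g z) (c z))"
    if "recursive r" "recursive x" "recursive g" "recursive c" for r x g c
    unfolding teaching_gadgets.approx_set_def[OF teaching_gadgets_rho_of] mem_Collect_eq
    by (intro sg_disj sg_conj sg_ex K lim sg1_rho_of[OF R] sg_dec rec_intros that
        that[THEN recursive_compose])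
  have "y \<in> gadget_member W R x k \<longleftrightarrow> p1 y = p1 k \<and>
     ((p2 k = 0 \<and> p2 y \<in> teaching_gadgets.limit_set (rho_of R x) (collapsed W) (p1 k)) \<or>
      (p2 k \<noteq> 0 \<and> p2 y \<in> teaching_gadgets.approx_set (rho_of R x) (collapsed W) (p1 k) (p2 k - 1)))"
    for x k y
    using teaching_gadgets.pr_in_member_iff[OF teaching_gadgets_rho_of, of "p1 y" "p2 y" R x "collapsed W" k]
    by (auto simp: teaching_gadgets.gadget_set_def[OF teaching_gadgets_rho_of])
  moreover have "sg (Suc 0) (\<lambda>z. p1 (p2 (p2 z)) = p1 (p1 (p2 z)) \<and>
     ((p2 (p1 (p2 z)) = 0 \<and>
        p2 (p2 (p2 z)) \<in> teaching_gadgets.limit_set (rho_of R (p1 z)) (collapsed W) (p1 (p1 (p2 z)))) \<or>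
      (p2 (p1 (p2 z)) \<noteq> 0 \<and> p2 (p2 (p2 z)) \<in> teaching_gadgets.approx_set (rho_of R (p1 z)) (collapsed W)
         (p1 (p1 (p2 z))) (p2 (p1 (p2 z)) - 1))))"
    by (intro sg_conj sg_disj lim app sg_dec rec_intros)
  ultimately show ?thesis by (simp add: re_iff_sg)
qed

lemma Sigma5_reducible_R_plus_ure:
  assumes W: "acceptable_numbering W" and B: "Sigma0 5 B"
  shows "many_one_reducible B (R_plus_ure W)"
proof -
  have range_W: "range W = {A. re A}" and re_W: "re {prod_encode (e, x) | e x. x \<in> W e}"
    using W by (simp_all add: acceptable_numbering_def)
  obtain P where P: "pg 3 P" "\<And>x w. x \<notin> B \<Longrightarrow> \<exists>b. P (pr (pr w b) x)"
    "\<And>x. x \<in> B \<Longrightarrow> finite {g. P (pr g x)}"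
    using Sigma5_finitely_many_Pi3[OF B] by blast
  have "sg (Suc (Suc (Suc 0))) (\<lambda>z. \<not> P z)"
    using sg_not[OF P(1)] by (simp add: eval_nat_numeral)
  then obtain Q where Q: "pg (Suc (Suc 0)) Q" "\<And>z. \<not> P z \<longleftrightarrow> (\<exists>c. Q (pr c z))"
    unfolding sg_Suc[of "Suc (Suc 0)"] by blast
  then obtain R where R: "sg 1 R" "\<And>z. Q z \<longleftrightarrow> (\<forall>n. R (pr n z))"
    unfolding pg_Suc One_nat_def by blast
  \<comment> \<open>\<open>\<not> P\<close> has the form \<open>\<exists>c. \<forall>n. R\<close>,
    so \<open>P\<close> says that every counter of the gadget is finite.\<close>
  have rho: "(\<forall>c. \<exists>n. \<not> rho_of R x g c n) \<longleftrightarrow> P (pr g x)" for x g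
    unfolding rho_of_bounded_iff using Q(2)[of "pr g x"] R(2) by blast
  let ?V = "{z. p2 (p2 z) \<in> gadget_member W R (p1 z) (p1 (p2 z))}"
  have V: "re ?V" using re_gadget_member[OF R(1) re_W] .
  \<comment> \<open>Translating the uniform enumeration \<open>?V\<close> into the acceptable
    numbering gives the reduction.\<close>
  with W obtain f where f: "recursive f" "\<And>x. W (f x) = {u. pr x u \<in> ?V}"
    unfolding acceptable_numbering_def by blast
  have "lang W (f x) = gadget_member W R x" for x
    by (auto simp: fun_eq_iff lang_def f(2))
  then have fam: "lang_family W (f x) = range (gadget_member W R x)" for x
    by (simp add: lang_family_def)
  have "x \<in> B \<longleftrightarrow> f x \<in> R_plus_ure W" for x
  proof
    assume x: "x \<in> B"
    interpret teaching_gadgets "rho_of R x" "collapsed W" by (rule teaching_gadgets_rho_of)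
    have "{g. failed g} \<subseteq> {g. P (pr g x)}"
      unfolding failed_def using rho[of x] by blast
    with P(3)[OF x] have fin: "finite {g. failed g}" by (rule finite_subset[rotated])
    have "{pr k y | k y. y \<in> gadget_member W R x k} = W (f x)"
      unfolding f(2) by auto (metis pr_p1_p2)
    then have "re {pr k y | k y. y \<in> gadget_member W R x k}" using range_W by auto
    from finitely_many_failed_imp_teachable[OF fin this] obtain N F d
      where p: "positive_teaching_seq (lang_family W (f x)) N F d"
        and "uniformly_re_seq N F" and o: "seq_order N d < \<infinity>"
      unfolding fam by blast
    moreover have "RTD_plus (lang_family W (f x)) < \<infinity>"
      using le_less_trans[OF RTD_plus_le[OF p] o] .
    ultimately show "f x \<in> R_plus_ure W" unfolding R_plus_ure_def by blast
  next
    assume "f x \<in> R_plus_ure W"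
    then obtain N F d where p: "positive_teaching_seq (lang_family W (f x)) N F d"
      and u: "uniformly_re_seq N F"
      unfolding R_plus_ure_def by blast
    obtain v where F: "\<And>i. i \<in> indices N \<Longrightarrow> F i = range (re_family W v i)"
      using uniformly_re_seq_index[OF range_W u] by blast
    obtain c where c: "\<And>i. i \<in> indices N \<longleftrightarrow> is_index c i" using ex_indices_code by blast
    show "x \<in> B"
    proof (rule ccontr)
      assume "x \<notin> B"
      \<comment> \<open>With \<open>w = pr v c\<close> the gadget watches exactly the given
        sequence.\<close>
      from P(2)[OF this] obtain b where b: "P (pr (pr (pr v c) b) x)" by blast
      let ?g = "pr (pr v c) b"
      have "\<not> positive_teaching_seq (range (gadget_member W R x)) N F d"
      proof (rule teaching_gadgets.unfulfilled_imp_not_teaching_seq[OF teaching_gadgets_rho_of])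
        show "\<exists>n. \<not> rho_of R x ?g c' n" for c' using rho[of x ?g] b by blast
        show "collapsed W ?g \<longleftrightarrow> (\<exists>i\<in>indices N. \<exists>i'\<in>indices N. i \<noteq> i' \<and>
            (\<exists>A\<in>F i. \<exists>A'\<in>F i'. \<exists>r r'. pr ?g r \<in> A \<and> pr ?g r' \<in> A'))"
          by (rule collapsed_iff[OF _ _ c F]) simp_all
      qed
      with p show False by (simp add: fam)
    qed
  qed
  with f(1) show ?thesis unfolding many_one_reducible_def by blast
qed

theorem theorem15:
  fixes W :: "nat \<Rightarrow> nat set"
  assumes "acceptable_numbering W"
  shows "Sigma0_complete 5 (R_plus_ure W)"
  unfolding Sigma0_complete_def
  using assms Sigma0_R_plus_ure[of W] Sigma5_reducible_R_plus_ure[OF assms]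
  by (simp add: acceptable_numbering_def)

end
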